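(* Let $G\subset\mathrm{PGL}(n+2,\mathbb{C})$ be the finite abelian group generated by $[A_1],\dots,[A_k]$, where $A_i=\mathrm{diag}(\lambda_{i1},\dots,\lambda_{i(n+1)},1)$ with all $\lambda_{ij}$ roots of unity. Let $F\in\mathbb{C}[x_1,\dots,x_{n+2}]$ be an irreducible homogeneous polynomial of degree $d\geq 2$ such that $F(\lambda_{i1}x_1,\dots,\lambda_{i(n+1)}x_{n+1},x_{n+2})=F$ for all $i$, and let $X=\{F=0\}\subset\mathbb{P}^{n+1}$. Then every Noether--Cremona hypersurface $X_{NC}\subset\mathbb{P}^{n+1}$ of $X/G$ is birational to $X/G$.
   Context: The group $G$ acts on $\mathbb{P}^{n+1}$ by $[A_i]\cdot(x_1:\cdots:x_{n+2})=(\lambda_{i1}x_1:\cdots:\lambda_{i(n+1)}x_{n+1}:x_{n+2})$ and preserves $X$. Let $\tilde G\subset\mathrm{GL}(n+2,\mathbb{C})$ be the group generated by $A_1,\dots,A_k$; it acts on $\mathbb{C}[x_1,\dots,x_{n+2}]$ by $A_i(f)=f(\lambda_{i1}x_1,\dots,\lambda_{i(n+1)}x_{n+1},x_{n+2})$, and hence acts on $\mathbb{C}(x_1,\dots,x_{n+1})$. A rational monomial in $x_1,\dots,x_{n+1}$ is an element $x_1^{\alpha_1}\cdots x_{n+1}^{\alpha_{n+1}}$ with all $\alpha_i\in\mathbb{Z}$. Noether--Cremona hypersurfaces of $X/G$ are obtained as follows. (1) Choose rational monomials $u_i=x_1^{a_{i1}}\cdots x_{n+1}^{a_{i(n+1)}}$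 ($1\le i\le n+1$) such that $\mathbb{C}(x_1,\dots,x_{n+1})^{\tilde G}=\mathbb{C}(u_1,\dots,u_{n+1})$ (such a choice always exists). (2) Put $f(x_1,\dots,x_{n+1})=F(x_1,\dots,x_{n+1},1)$. There are $p\in\mathbb{C}[u_1,\dots,u_{n+1}]$ and a monomial $q=u_1^{a_1'}\cdots u_{n+1}^{a_{n+1}'}$ (all $a_i'\geq 0$) with $f=p/q$ and $\gcd(p,q)=1$. (3) Substitute $u_i=x_i/x_{n+2}$ in $p$ and write $p(x_1/x_{n+2},\dots,x_{n+1}/x_{n+2})=p_1/q_1$ with $p_1\in\mathbb{C}[x_1,\dots,x_{n+2}]$, $q_1=x_{n+2}^{d'}$ and $\gcd(p_1,q_1)=1$. Then $p_1$ is homogeneous of degree $d'$. Put $F_{NC}:=p_1$ and $X_{NC}:=\{F_{NC}=0\}\subset\mathbb{P}^{n+1}$; any hypersurface $X_{NC}$ so obtained is called a Noether--Cremona hypersurface of $X/G$.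
   Formalization: "Birational" here means having isomorphic nonempty open subsets, with density not required on X_NC: X_NC may be reducible (e.g. x2(x1+x2) from x1x3+x2^2 with u1=x1/x2, u2=x2), where the usual claim fails; for irreducible X_NC it is ordinary birationality. *)

theory Defs
  imports
    "HOL-Analysis.Analysis"
    "HOL-Algebra.Coset"
    "HOL-Algebra.Generated_Groups"
    "HOL-Algebra.Group_Action"
    "HOL-Library.Poly_Mapping"
    "HOL-Library.Option_ord"
    "HOL-Computational_Algebra.Factorial_Ring"
    "HOL-Computational_Algebra.Fraction_Field"
begin

section \<open>Polynomials and rational functions over the complex numbers\<close>

text \<open>
  The affine coordinates \<open>x\<^sub>1, \<dots>, x\<^sub>n\<^sub>+\<^sub>1\<close> are indexed by a finite type \<open>'n\<close> with \<open>n + 1\<close> elements,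
  the homogeneous coordinates \<open>x\<^sub>1, \<dots>, x\<^sub>n\<^sub>+\<^sub>2\<close> by \<open>'n option\<close>, where \<open>None\<close> stands for the last
  index \<open>n + 2\<close>.  The linear order on the index types serves only to make the polynomial rings
  instances of class \<open>idom\<close>, so that the type of fractions is available.
\<close>

type_synonym 'v mpoly = "('v \<Rightarrow>\<^sub>0 nat) \<Rightarrow>\<^sub>0 complex"

definition Const :: "complex \<Rightarrow> 'v mpoly" where
  "Const c = Poly_Mapping.single 0 c"

definition Var :: "'v \<Rightarrow> 'v mpoly" where
  "Var v = Poly_Mapping.single (Poly_Mapping.single v 1) 1"

text \<open>Evaluation at \<open>x\<close> in an algebra whose structure map is \<open>h\<close>.\<close>

definition insertion ::
  "(complex \<Rightarrow> 'b::comm_ring_1) \<Rightarrow> ('v::finite \<Rightarrow> 'b) \<Rightarrow> 'v mpoly \<Rightarrow> 'b" where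
  "insertion h x p =
     (\<Sum>m\<in>Poly_Mapping.keys p.
        h (Poly_Mapping.lookup p m) * (\<Prod>v\<in>UNIV. x v ^ Poly_Mapping.lookup m v))"

definition homogeneous :: "nat \<Rightarrow> 'v::finite mpoly \<Rightarrow> bool" where
  "homogeneous d p \<longleftrightarrow>
     (\<forall>m\<in>Poly_Mapping.keys p. (\<Sum>v\<in>UNIV. Poly_Mapping.lookup m v) = d)"

text \<open>\<^const>\<open>coprime\<close> needs a division operation, which \<^typ>\<open>'v mpoly\<close> does not have.\<close>

definition relatively_prime :: "'v mpoly \<Rightarrow> 'v mpoly \<Rightarrow> bool" where
  "relatively_prime p q \<longleftrightarrow> (\<forall>c. c dvd p \<longrightarrow> c dvd q \<longrightarrow> c dvd 1)"

definition scale_vars :: "('v::finite \<Rightarrow> complex) \<Rightarrow> 'v mpoly \<Rightarrow> 'v mpoly" where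
  "scale_vars t = insertion Const (\<lambda>v. Const (t v) * Var v)"

definition dehomogenize :: "'n::finite option mpoly \<Rightarrow> 'n mpoly" where
  "dehomogenize = insertion Const (case_option 1 Var)"

type_synonym 'v ratfun = "'v mpoly fract"

definition of_mpoly :: "'v::{finite,linorder} mpoly \<Rightarrow> 'v ratfun" where
  "of_mpoly p = Fract p 1"

definition ratfun_const :: "complex \<Rightarrow> 'v::{finite,linorder} ratfun" where
  "ratfun_const c = of_mpoly (Const c)"

definition ratfun_var :: "'v \<Rightarrow> 'v::{finite,linorder} ratfun" where
  "ratfun_var v = of_mpoly (Var v)"

text \<open>
  The extension of \<^term>\<open>scale_vars t\<close> to the field of rational functions; it is well defined
  when all \<open>t v\<close> are nonzero, see \<open>scale_ratfun_Fract\<close> below.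
\<close>

definition scale_ratfun ::
  "('v \<Rightarrow> complex) \<Rightarrow> 'v::{finite,linorder} ratfun \<Rightarrow> 'v ratfun" where
  "scale_ratfun t r =
     (THE s. \<exists>a b. b \<noteq> 0 \<and> r = Fract a b \<and> s = Fract (scale_vars t a) (scale_vars t b))"

text \<open>The subfield generated over the complex numbers by \<open>S\<close>.\<close>

inductive_set adjoin :: "'v::{finite,linorder} ratfun set \<Rightarrow> 'v ratfun set"
  for S :: "'v ratfun set" where
  const: "ratfun_const c \<in> adjoin S"
| gen: "s \<in> S \<Longrightarrow> s \<in> adjoin S"
| add: "a \<in> adjoin S \<Longrightarrow> b \<in> adjoin S \<Longrightarrow> a + b \<in> adjoin S"
| mult: "a \<in> adjoin S \<Longrightarrow> b \<in> adjoin S \<Longrightarrow> a * b \<in> adjoin S"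
| inverse: "a \<in> adjoin S \<Longrightarrow> inverse a \<in> adjoin S"

definition rational_monomial :: "('v \<Rightarrow> int) \<Rightarrow> 'v::{finite,linorder} ratfun" where
  "rational_monomial \<alpha> = (\<Prod>v\<in>UNIV. ratfun_var v powi \<alpha> v)"


section \<open>The groups\<close>

definition GL :: "(complex^'v::finite^'v) monoid" where
  "GL = \<lparr>carrier = {A. invertible A}, mult = (**), one = mat 1\<rparr>"

definition scalars :: "(complex^'v::finite^'v) set" where
  "scalars = {mat c |c. c \<noteq> 0}"

definition PGL :: "(complex^'v::finite^'v) set monoid" where
  "PGL = GL Mod scalars"

definition diag :: "('v \<Rightarrow> complex) \<Rightarrow> complex^'v::finite^'v" where
  "diag t = (\<chi> i j. if i = j then t i else 0)"

text \<open>The matrices \<open>A\<^sub>i\<close>; the index \<open>i\<close> ranges over \<open>0, \<dots>, k - 1\<close>.\<close>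

definition gen_matrix ::
  "(nat \<Rightarrow> 'n \<Rightarrow> complex) \<Rightarrow> nat \<Rightarrow> complex^'n::finite option^'n option" where
  "gen_matrix lam i = diag (case_option 1 (lam i))"

definition lifted_group ::
  "nat \<Rightarrow> (nat \<Rightarrow> 'n \<Rightarrow> complex) \<Rightarrow> (complex^'n::finite option^'n option) set" where
  "lifted_group k lam = generate GL (gen_matrix lam ` {..<k})"

definition diag_group ::
  "nat \<Rightarrow> (nat \<Rightarrow> 'n \<Rightarrow> complex) \<Rightarrow> (complex^'n::finite option^'n option) set monoid" where
  "diag_group k lam =
     PGL\<lparr>carrier := generate PGL ((\<lambda>i. scalars #>\<^bsub>GL\<^esub> gen_matrix lam i) ` {..<k})\<rparr>"


section \<open>Projective space and its Zariski topology\<close>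

text \<open>A point is represented by the set of its homogeneous coordinate vectors.\<close>

definition proj_points :: "(complex^'v::finite) set set" where
  "proj_points = {{c *s x |c. c \<noteq> 0} |x. x \<noteq> 0}"

text \<open>A class \<open>g\<close> in \<^const>\<open>PGL\<close> is a set of matrices, any of which computes the action on points.\<close>

definition proj_action ::
  "(complex^'v::finite^'v) set \<Rightarrow> (complex^'v) set \<Rightarrow> (complex^'v) set" where
  "proj_action g P = {A *v x |A x. A \<in> g \<and> x \<in> P}"

definition eval_at :: "'v::finite mpoly \<Rightarrow> complex^'v \<Rightarrow> complex" where
  "eval_at p x = insertion id (($) x) p"

definition zero_locus :: "'v::finite mpoly set \<Rightarrow> (complex^'v) set set" where
  "zero_locus S = {P \<in> proj_points. \<forall>p\<in>S. \<forall>x\<in>P. eval_at p x = 0}"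

definition hypersurface :: "'v::finite mpoly \<Rightarrow> (complex^'v) set set" where
  "hypersurface p = zero_locus {p}"

definition zariski_topology :: "(complex^'v::finite) set topology" where
  "zariski_topology =
     topology (\<lambda>U. \<exists>S. (\<forall>p\<in>S. \<exists>d. homogeneous d p) \<and> U = proj_points - zero_locus S)"


section \<open>Spaces with functions\<close>

text \<open>
  Varieties and their quotients are treated as topological spaces with a sheaf of
  complex-valued functions: \<open>regular Y U h\<close> says that \<open>h\<close> restricted to the open set \<open>U\<close> is a
  section.  Only the values of \<open>h\<close> on \<open>U\<close> matter.
\<close>

record 'p fun_space =
  space_top :: "'p topology"
  regular :: "'p set \<Rightarrow> ('p \<Rightarrow> complex) \<Rightarrow> bool"

abbreviation points :: "('p, 'z) fun_space_scheme \<Rightarrow> 'p set" where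
  "points Y \<equiv> topspace (space_top Y)"

definition proj_variety :: "(complex^'v::finite) set set \<Rightarrow> (complex^'v) set fun_space" where
  "proj_variety V =
    \<lparr>space_top = subtopology zariski_topology V,
     regular = (\<lambda>U h. \<forall>P\<in>U. \<exists>W d a b.
        openin (subtopology zariski_topology V) W \<and> P \<in> W \<and> W \<subseteq> U \<and>
        homogeneous d a \<and> homogeneous d b \<and>
        (\<forall>Q\<in>W. \<forall>x\<in>Q. eval_at b x \<noteq> 0 \<and> h Q = eval_at a x / eval_at b x))\<rparr>"

text \<open>
  The quotient of a space with functions by a group: the orbit space with the quotient
  topology, a function being regular iff its pullback along the orbit map is.  For a finite group
  acting on a projective variety this is the quotient variety.
\<close>

definition quotient_space ::
  "'p fun_space \<Rightarrow> ('g, 'm) monoid_scheme \<Rightarrow> ('g \<Rightarrow> 'p \<Rightarrow> 'p) \<Rightarrow> 'p set fun_space" where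
  "quotient_space Y G \<phi> =
    \<lparr>space_top = topology (\<lambda>U. U \<subseteq> orbits G (points Y) \<phi> \<and>
        openin (space_top Y) {P \<in> points Y. orbit G \<phi> P \<in> U}),
     regular = (\<lambda>U h. regular Y {P \<in> points Y. orbit G \<phi> P \<in> U} (\<lambda>P. h (orbit G \<phi> P)))\<rparr>"

definition open_subspace :: "'p fun_space \<Rightarrow> 'p set \<Rightarrow> 'p fun_space" where
  "open_subspace Y U = Y\<lparr>space_top := subtopology (space_top Y) U\<rparr>"

definition morphism :: "'p fun_space \<Rightarrow> 'q fun_space \<Rightarrow> ('p \<Rightarrow> 'q) \<Rightarrow> bool" where
  "morphism Y Z f \<longleftrightarrow>
     continuous_map (space_top Y) (space_top Z) f \<and>
     (\<forall>W h. openin (space_top Z) W \<and> regular Z W h \<longrightarrow>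
        regular Y {P \<in> points Y. f P \<in> W} (h \<circ> f))"

definition isomorphic :: "'p fun_space \<Rightarrow> 'q fun_space \<Rightarrow> bool" where
  "isomorphic Y Z \<longleftrightarrow>
     (\<exists>f g. morphism Y Z f \<and> morphism Z Y g \<and>
        (\<forall>P\<in>points Y. g (f P) = P) \<and> (\<forall>Q\<in>points Z. f (g Q) = Q))"

text \<open>
  Birational means that there are isomorphic nonempty open subsets.  In an irreducible space
  nonempty open subsets are dense.  Density is not required separately because a
  Noether--Cremona hypersurface may be reducible: for the trivial group in dimension one,
  the conic \<open>x\<^sub>1 x\<^sub>3 + x\<^sub>2\<^sup>2\<close> with \<open>u\<^sub>1 = x\<^sub>1 / x\<^sub>2\<close> and \<open>u\<^sub>2 = x\<^sub>2\<close> yields \<open>x\<^sub>2 (x\<^sub>1 + x\<^sub>2)\<close>.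
\<close>

definition birational :: "'p fun_space \<Rightarrow> 'q fun_space \<Rightarrow> bool" where
  "birational Y Z \<longleftrightarrow>
     (\<exists>U V. openin (space_top Y) U \<and> U \<noteq> {} \<and> openin (space_top Z) V \<and> V \<noteq> {} \<and>
        isomorphic (open_subspace Y U) (open_subspace Z V))"


section \<open>Noether--Cremona hypersurfaces\<close>

text \<open>
  The group \<open>H\<close> consists of diagonal matrices with last entry 1, so \<open>A \<in> H\<close> acts on the affine
  coordinate \<open>x\<^sub>j\<close> through the diagonal entry at \<open>Some j\<close>.  The polynomials \<open>p\<close> and \<open>q\<close> in
  \<open>u\<^sub>1, \<dots>, u\<^sub>n\<^sub>+\<^sub>1\<close> are written as formal polynomials in variables indexed by \<open>'n\<close>.
\<close>

definition noether_cremona_hypersurface ::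
  "(complex^'n::{finite,linorder} option^'n option) set \<Rightarrow> 'n option mpoly \<Rightarrow>
   (complex^'n option) set set \<Rightarrow> bool" where
  "noether_cremona_hypersurface H F Y \<longleftrightarrow>
    (\<exists>(\<alpha> :: 'n \<Rightarrow> 'n \<Rightarrow> int) (p :: 'n mpoly) (\<beta> :: 'n \<Rightarrow> nat) (q :: 'n mpoly) p\<^sub>1 q\<^sub>1 d'.
       {r. \<forall>A\<in>H. scale_ratfun (\<lambda>j. A $ Some j $ Some j) r = r} =
         adjoin (range (\<lambda>i. rational_monomial (\<alpha> i))) \<and>
       q = (\<Prod>i\<in>UNIV. Var i ^ \<beta> i) \<and>
       of_mpoly (dehomogenize F) =
         insertion ratfun_const (\<lambda>i. rational_monomial (\<alpha> i)) p /
         insertion ratfun_const (\<lambda>i. rational_monomial (\<alpha> i)) q \<and>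
       relatively_prime p q \<and>
       q\<^sub>1 = Var None ^ d' \<and>
       insertion ratfun_const (\<lambda>i. ratfun_var (Some i) / ratfun_var None) p =
         of_mpoly p\<^sub>1 / of_mpoly q\<^sub>1 \<and>
       relatively_prime p\<^sub>1 q\<^sub>1 \<and>
       Y = hypersurface p\<^sub>1)"


section \<open>Well-definedness\<close>

lemma insertion_add:
  assumes h: "h 0 = 0" "\<And>a b. h (a + b) = h a + h b"
  shows "insertion h x (p + q) = insertion h x p + insertion h x q"
proof -
  let ?S = "Poly_Mapping.keys p \<union> Poly_Mapping.keys q"
  have *: "insertion h x r = (\<Sum>m\<in>?S. h (Poly_Mapping.lookup r m) *
      (\<Prod>v\<in>UNIV. x v ^ Poly_Mapping.lookup m v))"
    if "Poly_Mapping.keys r \<subseteq> ?S" for r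
    unfolding insertion_def using that h(1)
    by (intro sum.mono_neutral_left) (auto simp: in_keys_iff)
  show ?thesis
    by (simp add: * Poly_Mapping.keys_add lookup_add h(2) distrib_right sum.distrib)
qed

lemma insertion_single:
  "h 0 = 0 \<Longrightarrow> insertion h x (Poly_Mapping.single m c) =
     h c * (\<Prod>v\<in>UNIV. x v ^ Poly_Mapping.lookup m v)"
  by (simp add: insertion_def)

lemma mpoly_induct [case_names zero add]:
  assumes "P 0"
    and "\<And>p m c. P p \<Longrightarrow> P (Poly_Mapping.single m c + p)"
  shows "P (p :: 'v mpoly)"
proof (induction p rule: Poly_Mapping.update_induct)
  case (update f a b)
  have "Poly_Mapping.update a b f = Poly_Mapping.single a b + f"
    using update(1)
    by (intro poly_mapping_eqI) (auto simp: lookup_update lookup_add lookup_single when_def in_keys_iff)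
  then show ?case using assms(2)[OF update(3)] by simp
qed (rule assms(1))

lemma insertion_mult:
  assumes h: "h 0 = 0" "\<And>a b. h (a + b) = h a + h b" "\<And>a b. h (a * b) = h a * h b"
  shows "insertion h x (p * q) = insertion h x p * insertion h x q"
proof (induction p rule: mpoly_induct)
  case zero
  then show ?case by (simp add: insertion_def)
next
  case (add p m c)
  have "insertion h x (Poly_Mapping.single m c * q) =
      insertion h x (Poly_Mapping.single m c) * insertion h x q"
  proof (induction q rule: mpoly_induct)
    case zero
    then show ?case by (simp add: insertion_def)
  next
    case (add q m' c')
    then show ?case
      by (simp add: distrib_left insertion_add[OF h(1,2)] mult_single insertion_single h
          lookup_add power_add prod.distrib mult_ac)
  qed
  with add show ?case
    by (simp add: distrib_right insertion_add[OF h(1,2)])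
qed

lemma Const_hom:
  "Const 0 = 0" "Const (a + b) = Const a + Const b" "Const (a * b) = Const a * Const b"
  "Const 1 = 1"
  by (simp_all add: Const_def single_add mult_single)

lemma Const_power: "Const c ^ k = Const (c ^ k)"
  by (induction k) (simp_all add: Const_hom)

lemma Const_prod: "finite S \<Longrightarrow> (\<Prod>v\<in>S. Const (f v)) = Const (\<Prod>v\<in>S. f v)"
  by (induction S rule: finite_induct) (simp_all add: Const_hom)

lemma Var_power: "Var v ^ k = Poly_Mapping.single (Poly_Mapping.single v k) 1"
  by (induction k) (simp_all add: Var_def mult_single flip: single_add)

lemma prod_Var_power:
  "(\<Prod>v\<in>UNIV. Var v ^ Poly_Mapping.lookup m v) = Poly_Mapping.single (m :: 'v::finite \<Rightarrow>\<^sub>0 nat) 1"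
proof -
  have "(\<Prod>v\<in>S. Var v ^ Poly_Mapping.lookup m v) =
      Poly_Mapping.single (\<Sum>v\<in>S. Poly_Mapping.single v (Poly_Mapping.lookup m v)) 1"
    if "finite S" for S :: "'v set"
    using that by (induction S rule: finite_induct) (simp_all add: Var_power mult_single)
  moreover have "(\<Sum>v\<in>UNIV. Poly_Mapping.single v (Poly_Mapping.lookup m v)) = m"
    by (rule poly_mapping_eqI) (simp add: lookup_sum lookup_single when_def)
  ultimately show ?thesis by simp
qed

lemma scale_vars_single:
  "scale_vars t (Poly_Mapping.single m c) =
     Poly_Mapping.single m (c * (\<Prod>v\<in>UNIV. t v ^ Poly_Mapping.lookup m v))"
proof -
  have "scale_vars t (Poly_Mapping.single m c) =
      Const c * ((\<Prod>v\<in>UNIV. Const (t v ^ Poly_Mapping.lookup m v)) *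
        (\<Prod>v\<in>UNIV. Var v ^ Poly_Mapping.lookup m v))"
    by (simp add: scale_vars_def insertion_single Const_hom power_mult_distrib Const_power
        prod.distrib)
  also have "\<dots> = Poly_Mapping.single m (c * (\<Prod>v\<in>UNIV. t v ^ Poly_Mapping.lookup m v))"
    by (simp add: prod_Var_power Const_prod) (simp add: Const_def mult_single)
  finally show ?thesis .
qed

lemma scale_vars_add: "scale_vars t (p + q) = scale_vars t p + scale_vars t q"
  by (simp add: scale_vars_def insertion_add Const_hom)

lemma scale_vars_mult: "scale_vars t (p * q) = scale_vars t p * scale_vars t q"
  by (simp add: scale_vars_def insertion_mult Const_hom)

lemma scale_vars_0 [simp]: "scale_vars t 0 = 0"
  by (simp add: scale_vars_def insertion_def)

lemma scale_vars_inverse: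
  assumes "\<And>v. t v \<noteq> 0"
  shows "scale_vars (\<lambda>v. inverse (t v)) (scale_vars t p) = p"
proof (induction p rule: mpoly_induct)
  case (add p m c)
  have "(\<Prod>v\<in>UNIV. t v ^ Poly_Mapping.lookup m v) *
      (\<Prod>v\<in>UNIV. inverse (t v) ^ Poly_Mapping.lookup m v) = 1"
    unfolding prod.distrib[symmetric] power_mult_distrib[symmetric] by (simp add: assms)
  then show ?case
    by (simp add: scale_vars_add scale_vars_single add mult.assoc)
qed simp

lemma scale_ratfun_Fract:
  assumes t: "\<And>v. t v \<noteq> 0" and b: "b \<noteq> 0"
  shows "scale_ratfun t (Fract a b) = Fract (scale_vars t a) (scale_vars t b)"
proof -
  have nz: "scale_vars t q \<noteq> 0" if "q \<noteq> 0" for q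
    using scale_vars_inverse[of t q] that t by auto
  show ?thesis
    unfolding scale_ratfun_def
  proof (rule the_equality)
    show "\<exists>a' b'. b' \<noteq> 0 \<and> Fract a b = Fract a' b' \<and>
        Fract (scale_vars t a) (scale_vars t b) = Fract (scale_vars t a') (scale_vars t b')"
      using b by blast
  next
    fix s
    assume "\<exists>a' b'. b' \<noteq> 0 \<and> Fract a b = Fract a' b' \<and>
        s = Fract (scale_vars t a') (scale_vars t b')"
    then obtain a' b' where *: "b' \<noteq> 0" "Fract a b = Fract a' b'"
        "s = Fract (scale_vars t a') (scale_vars t b')"
      by blast
    from * b have "a * b' = a' * b" by (simp add: eq_fract)
    then have "scale_vars t a * scale_vars t b' = scale_vars t a' * scale_vars t b"
      by (metis scale_vars_mult)
    then show "s = Fract (scale_vars t a) (scale_vars t b)"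
      using * b nz by (simp add: eq_fract)
  qed
qed

lemma group_GL: "group (GL :: (complex^'v::finite^'v) monoid)"
proof -
  have one: "invertible (mat 1 :: complex^'v^'v)"
    unfolding invertible_def by (rule exI[of _ "mat 1"]) simp
  show ?thesis
  proof (rule groupI)
    fix A :: "complex^'v^'v"
    assume "A \<in> carrier GL"
    then obtain B where "A ** B = mat 1" "B ** A = mat 1"
      by (auto simp: GL_def invertible_def)
    then have "B \<in> carrier GL" "B \<otimes>\<^bsub>GL\<^esub> A = \<one>\<^bsub>GL\<^esub>"
      unfolding GL_def invertible_def by auto
    then show "\<exists>B\<in>carrier GL. B \<otimes>\<^bsub>GL\<^esub> A = \<one>\<^bsub>GL\<^esub>"
      by blast
  qed (simp_all add: GL_def invertible_mult matrix_mul_assoc one)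
qed

lemma mat_mult_commute: "mat c ** A = A ** mat (c :: 'a :: comm_semiring_1)"
  by (simp add: matrix_matrix_mult_def mat_def vec_eq_iff if_distrib[of "\<lambda>x. x * _"]
      if_distrib[of "\<lambda>x. _ * x"] mult.commute cong: if_cong)

lemma mat_mult_mat: "mat a ** mat b = (mat (a * b) :: 'a::comm_semiring_1^'v::finite^'v)"
  by (simp add: matrix_matrix_mult_def mat_def vec_eq_iff if_distrib[of "\<lambda>x. x * _"]
      if_distrib[of "\<lambda>x. _ * x"] cong: if_cong)

lemma scalars_normal: "scalars \<lhd> (GL :: (complex^'v::finite^'v) monoid)"
proof -
  interpret group "GL :: (complex^'v^'v) monoid" by (rule group_GL)
  have inv_mat: "mat a ** mat (inverse a) = (mat 1 :: complex^'v^'v)" if "a \<noteq> 0" for a :: complex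
    using that by (simp add: mat_mult_mat)
  have carr: "mat a \<in> carrier (GL :: (complex^'v^'v) monoid)" if "a \<noteq> 0" for a :: complex
  proof -
    have "mat (inverse a) ** mat a = (mat 1 :: complex^'v^'v)"
      using that by (simp add: mat_mult_mat)
    with inv_mat[OF that] have "invertible (mat a :: complex^'v^'v)"
      unfolding invertible_def by blast
    then show ?thesis by (simp add: GL_def)
  qed
  have "subgroup scalars (GL :: (complex^'v^'v) monoid)"
  proof (rule subgroupI)
    show "scalars \<subseteq> carrier (GL :: (complex^'v^'v) monoid)"
      using carr by (auto simp: scalars_def)
    show "(scalars :: (complex^'v^'v) set) \<noteq> {}"
      unfolding scalars_def using one_neq_zero by blast
    fix A B :: "complex^'v^'v"
    assume "A \<in> scalars" "B \<in> scalars"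
    then obtain a b where *: "A = mat a" "B = mat b" "a \<noteq> 0" "b \<noteq> 0"
      by (auto simp: scalars_def)
    then have "A \<otimes>\<^bsub>GL\<^esub> B = mat (a * b)" "a * b \<noteq> 0"
      by (simp_all add: GL_def mat_mult_mat)
    then show "A \<otimes>\<^bsub>GL\<^esub> B \<in> scalars"
      unfolding scalars_def by blast
  next
    fix A :: "complex^'v^'v"
    assume "A \<in> scalars"
    then obtain a where a: "A = mat a" "a \<noteq> 0" by (auto simp: scalars_def)
    have "mat (inverse a) \<otimes>\<^bsub>GL\<^esub> A = \<one>\<^bsub>GL\<^esub>"
      using a by (simp add: GL_def mat_mult_mat)
    then have "inv\<^bsub>GL\<^esub> A = mat (inverse a)"
      using a carr[of a] carr[of "inverse a"] by (intro inv_equality) simp_all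
    moreover have "inverse a \<noteq> 0" using a(2) by simp
    ultimately show "inv\<^bsub>GL\<^esub> A \<in> scalars"
      unfolding scalars_def by blast
  qed
  then show ?thesis
  proof (rule normalI, intro ballI)
    fix A :: "complex^'v^'v"
    assume "A \<in> carrier GL"
    show "scalars #>\<^bsub>GL\<^esub> A = A <#\<^bsub>GL\<^esub> scalars"
      unfolding r_coset_def l_coset_def scalars_def by (auto simp: GL_def mat_mult_commute[of _ A])
  qed
qed

lemma group_PGL: "group (PGL :: (complex^'v::finite^'v) set monoid)"
  unfolding PGL_def by (rule normal.factorgroup_is_group[OF scalars_normal])

lemma homogeneous_mult:
  assumes "homogeneous d p" "homogeneous e q"
  shows "homogeneous (d + e) (p * q)"
  unfolding homogeneous_def
proof
  fix m assume "m \<in> Poly_Mapping.keys (p * q)"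
  then obtain a b where "m = a + b" "a \<in> Poly_Mapping.keys p" "b \<in> Poly_Mapping.keys q"
    using keys_mult[of p q] by auto
  then show "(\<Sum>v\<in>UNIV. Poly_Mapping.lookup m v) = d + e"
    using assms by (simp add: homogeneous_def lookup_add sum.distrib)
qed

lemma eval_at_homogeneous:
  assumes "homogeneous d p"
  shows "eval_at p (c *s x) = c ^ d * eval_at p x"
proof -
  have "(\<Prod>v\<in>UNIV. (c *s x) $ v ^ Poly_Mapping.lookup m v) =
      c ^ d * (\<Prod>v\<in>UNIV. x $ v ^ Poly_Mapping.lookup m v)"
    if "m \<in> Poly_Mapping.keys p" for m
    using that assms
    by (simp add: homogeneous_def power_mult_distrib prod.distrib flip: power_sum)
  then show ?thesis
    by (simp add: eval_at_def insertion_def sum_distrib_left mult_ac cong: sum.cong)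
qed

lemma eval_at_mult: "eval_at (p * q) x = eval_at p x * eval_at q x"
  by (simp add: eval_at_def insertion_mult)

lemma proj_points_vanish_iff:
  assumes "P \<in> proj_points" "x \<in> P" "homogeneous d p"
  shows "(\<forall>y\<in>P. eval_at p y = 0) \<longleftrightarrow> eval_at p x = 0"
proof -
  obtain z where P: "P = {c *s z |c. c \<noteq> 0}" using assms(1) by (auto simp: proj_points_def)
  with assms show ?thesis by (auto simp: eval_at_homogeneous)
qed

lemma istopology_zariski:
  "istopology (\<lambda>U. \<exists>S. (\<forall>p\<in>S. \<exists>d. homogeneous d p) \<and>
     U = proj_points - zero_locus (S :: 'v::finite mpoly set))"
  unfolding istopology_def
proof (intro conjI allI impI)
  fix U V :: "(complex^'v) set set"
  assume "\<exists>S. (\<forall>p\<in>S. \<exists>d. homogeneous d p) \<and> U = proj_points - zero_locus S"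
    and "\<exists>S. (\<forall>p\<in>S. \<exists>d. homogeneous d p) \<and> V = proj_points - zero_locus S"
  then obtain S T where S: "\<forall>p\<in>S. \<exists>d. homogeneous d p" "U = proj_points - zero_locus S"
    and T: "\<forall>p\<in>T. \<exists>d. homogeneous d p" "V = proj_points - zero_locus T"
    by blast
  let ?R = "{p * q |p q. p \<in> S \<and> q \<in> T}"
  have R: "\<forall>p\<in>?R. \<exists>d. homogeneous d p"
    using S(1) T(1) homogeneous_mult by blast
  have pt: "P \<in> zero_locus ?R \<longleftrightarrow> P \<in> zero_locus S \<or> P \<in> zero_locus T"
    if P: "P \<in> proj_points" for P
  proof -
    obtain x where x: "x \<in> P"
      using P by (auto simp: proj_points_def intro: exI[of _ "1::complex"])
    have *: "P \<in> zero_locus Q \<longleftrightarrow> (\<forall>p\<in>Q. eval_at p x = 0)" if "\<forall>p\<in>Q. \<exists>d. homogeneous d p" for Q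
      using P that proj_points_vanish_iff[OF P x] by (fastforce simp: zero_locus_def)
    show ?thesis
      unfolding *[OF S(1)] *[OF T(1)] *[OF R]
      by (auto simp: eval_at_mult) (metis eval_at_mult mult_eq_0_iff)
  qed
  have "U \<inter> V = proj_points - zero_locus ?R"
    unfolding S(2) T(2) using pt by blast
  with R show "\<exists>S. (\<forall>p\<in>S. \<exists>d. homogeneous d p) \<and> U \<inter> V = proj_points - zero_locus S"
    by blast
next
  fix K :: "(complex^'v) set set set"
  assume "\<forall>U\<in>K. \<exists>S. (\<forall>p\<in>S. \<exists>d. homogeneous d p) \<and> U = proj_points - zero_locus S"
  then obtain S where S: "\<forall>U\<in>K. (\<forall>p\<in>S U. \<exists>d. homogeneous d p) \<and> U = proj_points - zero_locus (S U)"
    by metis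
  have "\<Union>K = proj_points - zero_locus (\<Union>U\<in>K. S U)"
  proof -
    have "\<Union>K = (\<Union>U\<in>K. proj_points - zero_locus (S U))"
      using S by blast
    also have "\<dots> = proj_points - zero_locus (\<Union>U\<in>K. S U)"
      by (auto simp: zero_locus_def)
    finally show ?thesis .
  qed
  moreover have "\<forall>p\<in>(\<Union>U\<in>K. S U). \<exists>d. homogeneous d p"
    using S by blast
  ultimately show "\<exists>S. (\<forall>p\<in>S. \<exists>d. homogeneous d p) \<and> \<Union>K = proj_points - zero_locus S"
    by blast
qed

lemma istopology_quotient:
  "istopology (\<lambda>U. U \<subseteq> orbits G (topspace T) \<phi> \<and>
     openin T {P \<in> topspace T. orbit G \<phi> P \<in> U})"
  unfolding istopology_def
proof (intro conjI allI impI)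
  fix U V
  assume *: "U \<subseteq> orbits G (topspace T) \<phi> \<and> openin T {P \<in> topspace T. orbit G \<phi> P \<in> U}"
    "V \<subseteq> orbits G (topspace T) \<phi> \<and> openin T {P \<in> topspace T. orbit G \<phi> P \<in> V}"
  then show "U \<inter> V \<subseteq> orbits G (topspace T) \<phi>" by blast
  have "{P \<in> topspace T. orbit G \<phi> P \<in> U \<inter> V} =
      {P \<in> topspace T. orbit G \<phi> P \<in> U} \<inter> {P \<in> topspace T. orbit G \<phi> P \<in> V}"
    by blast
  moreover have "openin T \<dots>"
    using * by (intro openin_Int) blast+
  ultimately show "openin T {P \<in> topspace T. orbit G \<phi> P \<in> U \<inter> V}"
    by (rule ssubst)
next
  fix K
  assume *: "\<forall>U\<in>K. U \<subseteq> orbits G (topspace T) \<phi> \<and> openin T {P \<in> topspace T. orbit G \<phi> P \<in> U}"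
  then show "\<Union>K \<subseteq> orbits G (topspace T) \<phi>" by blast
  have "{P \<in> topspace T. orbit G \<phi> P \<in> \<Union>K} = (\<Union>U\<in>K. {P \<in> topspace T. orbit G \<phi> P \<in> U})"
    by blast
  moreover have "openin T \<dots>"
    using * by (intro openin_Union) blast
  ultimately show "openin T {P \<in> topspace T. orbit G \<phi> P \<in> \<Union>K}"
    by (rule ssubst)
qed

end

theory Submission
  imports Defs "HOL-Computational_Algebra.Fundamental_Theorem_Algebra"
begin

text \<open>
  On the torus of points with nonzero coordinates, the monomials \<open>u\<^sub>i\<close> define a homomorphism whose kernel
  is the group: a point \<open>t\<close> of the kernel fixes every rational function in the \<open>u\<^sub>i\<close>, hence every invariant
  polynomial, and invariant polynomials separate the finite group from the points outside it.
  As this kernel is finite, the exponent matrix is nonsingular, so the homomorphism is onto, and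
  every invariant Laurent monomial is a Laurent monomial in the \<open>u\<^sub>i\<close>.  The torus modulo the group is
  thus again the torus, with the same regular functions.  From \<open>f = p / q\<close>, with \<open>q\<close> a monomial, a torus
  point lies on \<open>X\<close> iff its image lies on \<open>X\<^sub>N\<^sub>C\<close>, so that the torus part of \<open>X\<^sub>N\<^sub>C\<close> is isomorphic to the
  quotient of the torus part of \<open>X\<close>.  The latter is nonempty because \<open>F\<close> has at least two terms.
\<close>

section \<open>Evaluation of polynomials\<close>

text \<open>Since birationality is stated for spaces with functions, a bijection between points and
  orbits is not enough: open sets and regular functions have to correspond as well. The hard
  direction is descent. A regular function on the orbit space is known only locally, as a fraction
  of Laurent polynomials neither of which need be invariant, and summing the denominator over the
  group could make it vanish at the very point of interest. The invariant field enters only through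
  the description of the group as a kernel. From then on all statements concern values at points, so
  an identity of rational functions is used by evaluating it. The torus suits this because Laurent
  monomials are defined and nonzero there; hence \<open>q\<close> and the power of the last
  coordinate in \<open>q\<^sub>1\<close> can be divided by. The price is that a polynomial with a
  single term has no zero on the torus at all, which is why the number of terms of \<open>F\<close>
  matters.\<close>

definition poly_eval :: "('v::finite \<Rightarrow> complex) \<Rightarrow> 'v mpoly \<Rightarrow> complex" where
  "poly_eval x p = insertion id x p"

lemma eval_at_eq_poly_eval: "eval_at p x = poly_eval (($) x) p"
  by (simp only: eval_at_def poly_eval_def)

lemma poly_eval_single:
  "poly_eval x (Poly_Mapping.single m c) = c * (\<Prod>v\<in>UNIV. x v ^ Poly_Mapping.lookup m v)"
  by (simp add: poly_eval_def insertion_single)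

lemma poly_eval_zero [simp]: "poly_eval x 0 = 0"
  by (simp add: poly_eval_def insertion_def)

lemma poly_eval_Const [simp]: "poly_eval x (Const c) = c"
  by (simp add: Const_def poly_eval_single)

lemma poly_eval_one [simp]: "poly_eval x 1 = 1"
  using poly_eval_Const[of x 1] by (simp add: Const_hom)

lemma poly_eval_add [simp]: "poly_eval x (p + q) = poly_eval x p + poly_eval x q"
  by (simp add: poly_eval_def insertion_add)

lemma poly_eval_mult [simp]: "poly_eval x (p * q) = poly_eval x p * poly_eval x q"
  by (simp add: poly_eval_def insertion_mult)

lemma poly_eval_uminus [simp]: "poly_eval x (- p) = - poly_eval x p"
  using poly_eval_add[of x "- p" p] by (simp add: eq_neg_iff_add_eq_0)

lemma poly_eval_diff [simp]: "poly_eval x (p - q) = poly_eval x p - poly_eval x q"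
  using poly_eval_add[of x p "- q"] by simp

lemma poly_eval_power [simp]: "poly_eval x (p ^ k) = poly_eval x p ^ k"
  by (induction k) simp_all

lemma poly_eval_sum [simp]: "poly_eval x (sum f S) = (\<Sum>i\<in>S. poly_eval x (f i))"
  by (induction S rule: infinite_finite_induct) simp_all

lemma poly_eval_prod [simp]: "poly_eval x (prod f S) = (\<Prod>i\<in>S. poly_eval x (f i))"
  by (induction S rule: infinite_finite_induct) simp_all

lemma poly_eval_Var [simp]: "poly_eval x (Var v) = x v"
proof -
  have "(\<Prod>w\<in>UNIV. x w ^ Poly_Mapping.lookup (Poly_Mapping.single v 1) w) =
      (\<Prod>w\<in>UNIV. if w = v then x w else 1)"
    by (intro prod.cong) (auto simp: lookup_single when_def)
  then show ?thesis
    by (simp add: Var_def poly_eval_single)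
qed

lemma poly_eval_scale_vars: "poly_eval x (scale_vars t p) = poly_eval (\<lambda>v. t v * x v) p"
  by (induction p rule: mpoly_induct)
    (simp_all add: scale_vars_add scale_vars_single poly_eval_single power_mult_distrib
      prod.distrib mult_ac)

lemma poly_eval_dehomogenize:
  "poly_eval x (dehomogenize F) = poly_eval (case_option 1 x) F"
proof (induction F rule: mpoly_induct)
  case zero
  then show ?case by (simp add: dehomogenize_def insertion_def)
next
  case (add p m c)
  have *: "poly_eval x (case v of None \<Rightarrow> 1 | Some w \<Rightarrow> Var w) = (case v of None \<Rightarrow> 1 | Some w \<Rightarrow> x w)" for v
    by (simp split: option.split)
  have "poly_eval x (dehomogenize (Poly_Mapping.single m c)) =
      poly_eval (case_option 1 x) (Poly_Mapping.single m c)"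
    by (simp add: dehomogenize_def insertion_single Const_hom *) (simp add: poly_eval_single)
  with add show ?case
    by (simp add: dehomogenize_def insertion_add Const_hom)
qed

lemma poly_eval_homogeneous:
  "homogeneous d p \<Longrightarrow> poly_eval (\<lambda>v. c * x v) p = c ^ d * poly_eval x p"
  using eval_at_homogeneous[of d p c "\<chi> v. x v"]
  unfolding eval_at_eq_poly_eval vector_scalar_mult_def by (simp only: vec_lambda_inverse UNIV_I)

section \<open>Separation of points, and zeros without vanishing coordinates\<close>

text \<open>Each point \<open>b\<close> of \<open>B\<close> differs from \<open>x\<close> in some
  coordinate; the polynomial of degree one in that coordinate which is 0 at \<open>b\<close> and 1
  at \<open>x\<close> contributes one factor.\<close>

lemma exists_separating_polynomial:
  assumes "finite B" "x \<notin> B"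
  obtains g where "poly_eval x g = 1" "\<And>b. b \<in> B \<Longrightarrow> poly_eval b g = 0"
proof -
  have "\<exists>g. poly_eval x g = 1 \<and> (\<forall>b\<in>B. poly_eval b g = 0)"
    using assms
  proof (induction B rule: finite_induct)
    case empty
    then show ?case by (intro exI[of _ 1]) simp
  next
    case (insert b B)
    then obtain g where g: "poly_eval x g = 1" "\<forall>b\<in>B. poly_eval b g = 0" by auto
    obtain v where v: "x v \<noteq> b v" using insert.prems by auto
    show ?case
      using g v by (intro exI[of _ "g * (Var v - Const (b v)) * Const (1 / (x v - b v))"]) simp
  qed
  then show thesis using that by blast
qed

text \<open>Dividing out the highest power of the variable leaves a polynomial with nonzero constant
  term. Two nonzero coefficients keep it from being constant, and its roots cannot be 0.\<close>

lemma poly_nonzero_root: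
  fixes Q :: "complex poly"
  assumes "coeff Q i \<noteq> 0" "coeff Q j \<noteq> 0" "i \<noteq> j"
  obtains s where "s \<noteq> 0" "poly Q s = 0"
proof -
  have Q: "Q \<noteq> 0" using assms(1) by auto
  obtain R k where R: "Q = [:- 0, 1:] ^ k * R" "\<not> [:- 0, 1:] dvd R"
    using Polynomial.order_decomp[OF Q] by blast
  then have R0: "poly R 0 \<noteq> 0" by (simp add: poly_eq_0_iff_dvd)
  have Qm: "Q = monom 1 k * R" using R(1) by (simp add: monom_altdef)
  have "\<not> constant (poly R)"
  proof
    assume "constant (poly R)"
    then have "degree R = 0" by (simp add: constant_degree)
    then obtain c where "R = [:c:]" by (metis degree_eq_zeroE)
    then have "Q = monom c k" using Qm by (simp add: smult_monom)
    then show False using assms by (metis coeff_monom)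
  qed
  then obtain s where s: "poly R s = 0" using fundamental_theorem_of_algebra by blast
  then have "s \<noteq> 0" using R0 by auto
  moreover have "poly Q s = 0" using s by (subst R(1)) simp
  ultimately show thesis using that by blast
qed

text \<open>Weights of the form \<open>N\<^sup>0, N\<^sup>1, \<dots>\<close>, as in Kronecker's substitution.\<close>

lemma exists_injective_weights:
  fixes K :: "('v::finite \<Rightarrow>\<^sub>0 nat) set"
  assumes "finite K"
  obtains e :: "'v \<Rightarrow> nat" where "inj_on (\<lambda>m. \<Sum>v\<in>UNIV. e v * Poly_Mapping.lookup m v) K"
proof -
  obtain idx :: "'v \<Rightarrow> nat" where idx: "inj idx"
    using finite_imp_inj_to_nat_seg[OF finite_class.finite_UNIV] by auto
  \<comment> \<open>The value of \<open>D (m, m')\<close> at \<open>N\<close> is the difference of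
    the two weights in base \<open>N\<close>. Distinct powers \<open>idx v\<close> keep the
    coefficients apart, so \<open>D\<close> is nonzero for distinct exponents, and any natural
    number that misses the finitely many real roots can serve as base.\<close>
  define D :: "('v \<Rightarrow>\<^sub>0 nat) \<times> ('v \<Rightarrow>\<^sub>0 nat) \<Rightarrow> real poly" where
    "D = (\<lambda>(m, m'). \<Sum>v\<in>UNIV. monom (real (Poly_Mapping.lookup m v) - real (Poly_Mapping.lookup m' v)) (idx v))"
  have D: "D (m, m') \<noteq> 0" if neq: "m \<noteq> m'" for m m'
  proof -
    obtain w where w: "Poly_Mapping.lookup m w \<noteq> Poly_Mapping.lookup m' w"
      using neq by (meson poly_mapping_eqI)
    have "coeff (D (m, m')) (idx w) =
        (\<Sum>v\<in>UNIV. if v = w then real (Poly_Mapping.lookup m v) - real (Poly_Mapping.lookup m' v) else 0)"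
      unfolding D_def by (auto simp: coeff_sum inj_eq[OF idx] intro!: sum.cong)
    also have "\<dots> \<noteq> 0" using w by simp
    finally show ?thesis by auto
  qed
  let ?B = "\<Union>(m, m')\<in>K \<times> K - Id. {x. poly (D (m, m')) x = 0}"
  have "finite ?B"
    using assms D by (auto intro!: poly_roots_finite)
  then have "finite (real -` ?B)"
    by (rule finite_vimageI) (simp add: inj_on_def)
  then obtain N :: nat where "N \<notin> real -` ?B"
    using ex_new_if_finite[OF infinite_UNIV_nat] by blast
  then have N: "real N \<notin> ?B" by (simp only: vimage_eq not_False_eq_True)
  have "inj_on (\<lambda>m. \<Sum>v\<in>UNIV. N ^ idx v * Poly_Mapping.lookup m v) K"
  proof (rule inj_onI, rule ccontr)
    fix m m' assume m: "m \<in> K" "m' \<in> K" "m \<noteq> m'"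
      "(\<Sum>v\<in>UNIV. N ^ idx v * Poly_Mapping.lookup m v) = (\<Sum>v\<in>UNIV. N ^ idx v * Poly_Mapping.lookup m' v)"
    have "poly (D (m, m')) (real N) = real (\<Sum>v\<in>UNIV. N ^ idx v * Poly_Mapping.lookup m v) -
        real (\<Sum>v\<in>UNIV. N ^ idx v * Poly_Mapping.lookup m' v)"
      by (simp add: D_def poly_sum poly_monom algebra_simps sum_subtractf)
    with m N show False by auto
  qed
  then show thesis by (rule that)
qed

text \<open>Restricting \<open>p\<close> to the curve with coordinates \<open>s ^ e v\<close> gives
  a polynomial in \<open>s\<close>. Injective weights prevent terms from merging, so two terms of
  \<open>p\<close> leave two nonzero coefficients and hence a root
  \<open>s \<noteq> 0\<close>.\<close>

lemma exists_zero_with_nonzero_coordinates: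
  fixes p :: "'v::finite mpoly"
  assumes "m \<in> Poly_Mapping.keys p" "m' \<in> Poly_Mapping.keys p" "m \<noteq> m'"
  obtains z where "\<And>v. z v \<noteq> 0" "poly_eval z p = 0"
proof -
  obtain e :: "'v \<Rightarrow> nat" where e: "inj_on (\<lambda>m. \<Sum>v\<in>UNIV. e v * Poly_Mapping.lookup m v) (Poly_Mapping.keys p)"
    using exists_injective_weights[of "Poly_Mapping.keys p"] by auto
  define w where "w = (\<lambda>m. \<Sum>v\<in>UNIV. e v * Poly_Mapping.lookup m v)"
  define Q where "Q = (\<Sum>m\<in>Poly_Mapping.keys p. monom (Poly_Mapping.lookup p m) (w m))"
  have coeff: "coeff Q (w a) \<noteq> 0" if "a \<in> Poly_Mapping.keys p" for a
  proof -
    have "coeff Q (w a) = (\<Sum>m\<in>Poly_Mapping.keys p. if m = a then Poly_Mapping.lookup p m else 0)"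
      unfolding Q_def coeff_sum coeff_monom
      using e that by (intro sum.cong) (auto simp: inj_on_def w_def)
    also have "\<dots> \<noteq> 0" using that by (simp add: in_keys_iff)
    finally show ?thesis .
  qed
  have "w m \<noteq> w m'" using e assms by (auto simp: inj_on_def w_def)
  then obtain s where s: "s \<noteq> 0" "poly Q s = 0"
    using poly_nonzero_root[OF coeff coeff, OF assms(1,2)] by blast
  have "poly_eval (\<lambda>v. s ^ e v) p = poly Q s"
    by (simp add: poly_eval_def insertion_def Q_def poly_sum poly_monom w_def power_sum flip: power_mult)
  with s show thesis by (intro that[of "\<lambda>v. s ^ e v"]) simp_all
qed

text \<open>A single term of degree at least 2 splits into a variable and a monomial of positive
  degree, so it is reducible. In degree 1 a variable would be a counterexample, and its hypersurface
  misses the torus.\<close>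

lemma irreducible_homogeneous_two_keys:
  fixes F :: "'v::finite mpoly"
  assumes irr: "irreducible F" and hom: "homogeneous d F" and d: "d \<ge> 2"
  obtains m m' where "m \<in> Poly_Mapping.keys F" "m' \<in> Poly_Mapping.keys F" "m \<noteq> m'"
proof -
  \<comment> \<open>A form of positive degree vanishes at the origin, and so do its multiples,
    whereas 1 does not.\<close>
  have nonunit: "\<not> p dvd 1" if p: "homogeneous e p" "e \<noteq> 0" for p :: "'v mpoly" and e
  proof
    assume "p dvd 1"
    then obtain q where q: "1 = p * q" by (rule dvdE)
    have "poly_eval (\<lambda>v. 0) p = 0"
      using poly_eval_homogeneous[OF p(1), of 0 "\<lambda>v. 0"] p(2) by (simp add: power_0_left)
    then have "poly_eval (\<lambda>v. 0) (p * q) = 0" by simp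
    then show False by (simp flip: q)
  qed
  have single: "homogeneous (\<Sum>v\<in>UNIV. Poly_Mapping.lookup m v) (Poly_Mapping.single m c)"
    for m :: "'v \<Rightarrow>\<^sub>0 nat" and c
    by (simp add: homogeneous_def)
  have "F \<noteq> 0" using irr by auto
  then obtain m where m: "m \<in> Poly_Mapping.keys F" by (meson ex_in_conv keys_eq_empty)
  have "\<exists>m'\<in>Poly_Mapping.keys F. m \<noteq> m'"
  proof (rule ccontr)
    assume "\<not> ?thesis"
    then have F: "F = Poly_Mapping.single m (Poly_Mapping.lookup F m)"
      by (intro poly_mapping_eqI) (auto simp: lookup_single when_def in_keys_iff)
    have deg: "(\<Sum>v\<in>UNIV. Poly_Mapping.lookup m v) = d"
      using hom m by (simp add: homogeneous_def)
    then obtain v where v: "Poly_Mapping.lookup m v > 0"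
      using d by (metis (no_types, lifting) not_gr_zero not_numeral_le_zero sum.neutral)
    define m' where "m' = m - Poly_Mapping.single v 1"
    have m': "m = Poly_Mapping.single v 1 + m'"
      using v by (intro poly_mapping_eqI)
        (auto simp: m'_def lookup_add lookup_minus lookup_single when_def)
    have deg1: "(\<Sum>w\<in>UNIV. Poly_Mapping.lookup (Poly_Mapping.single v 1) w) = (1::nat)"
      by (simp add: lookup_single when_def)
    have "(\<Sum>v\<in>UNIV. Poly_Mapping.lookup m' v) \<noteq> 0"
      using deg d deg1 by (simp add: m' lookup_add sum.distrib del: sum_eq_0_iff)
    then have "\<not> Poly_Mapping.single m' (Poly_Mapping.lookup F m) dvd 1"
      by (rule nonunit[OF single])
    moreover have "\<not> Var v dvd 1"
      unfolding Var_def by (rule nonunit[OF single]) (simp only: deg1)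
    moreover have "F = Var v * Poly_Mapping.single m' (Poly_Mapping.lookup F m)"
      by (subst F) (simp add: Var_def mult_single m')
    ultimately show False using irr irreducibleD by blast
  qed
  then show thesis using m that by blast
qed

section \<open>Evaluation and scaling of rational functions\<close>

definition ratfun_eval :: "('v \<Rightarrow> complex) \<Rightarrow> 'v::{finite,linorder} ratfun \<Rightarrow> complex \<Rightarrow> bool" where
  "ratfun_eval x r c \<longleftrightarrow> (\<exists>a b. b \<noteq> 0 \<and> r = Fract a b \<and> poly_eval x b \<noteq> 0 \<and> c = poly_eval x a / poly_eval x b)"

lemma ratfun_eval_unique:
  assumes "ratfun_eval x r c" "ratfun_eval x r c'"
  shows "c = c'"
proof -
  obtain a b where ab: "b \<noteq> 0" "r = Fract a b" "poly_eval x b \<noteq> 0" "c = poly_eval x a / poly_eval x b"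
    using assms(1) by (auto simp: ratfun_eval_def)
  obtain a' b' where ab': "b' \<noteq> 0" "r = Fract a' b'" "poly_eval x b' \<noteq> 0" "c' = poly_eval x a' / poly_eval x b'"
    using assms(2) by (auto simp: ratfun_eval_def)
  have "a * b' = a' * b" using ab ab' by (simp add: eq_fract)
  then have "poly_eval x a * poly_eval x b' = poly_eval x a' * poly_eval x b"
    by (metis poly_eval_mult)
  with ab(3,4) ab'(3,4) show ?thesis by (simp add: frac_eq_eq)
qed

lemma ratfun_eval_of_mpoly: "ratfun_eval x (of_mpoly p) (poly_eval x p)"
  unfolding ratfun_eval_def of_mpoly_def by (intro exI[of _ p] exI[of _ 1]) simp

lemma ratfun_eval_const: "ratfun_eval x (ratfun_const c) c"
  using ratfun_eval_of_mpoly[of x "Const c"] by (simp add: ratfun_const_def)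

lemma ratfun_eval_var: "ratfun_eval x (ratfun_var v) (x v)"
  using ratfun_eval_of_mpoly[of x "Var v"] by (simp add: ratfun_var_def)

lemma ratfun_const_hom:
  "ratfun_const 0 = (0 :: 'v::{finite,linorder} ratfun)"
  "ratfun_const 1 = (1 :: 'v::{finite,linorder} ratfun)"
  "ratfun_const (a + b) = (ratfun_const a + ratfun_const b :: 'v::{finite,linorder} ratfun)"
  "ratfun_const (a * b) = (ratfun_const a * ratfun_const b :: 'v::{finite,linorder} ratfun)"
  by (simp_all add: ratfun_const_def of_mpoly_def Const_hom Zero_fract_def One_fract_def)

lemma ratfun_const_inverse:
  "ratfun_const (inverse c) = (inverse (ratfun_const c) :: 'v::{finite,linorder} ratfun)"
proof (cases "c = 0")
  case True
  then show ?thesis by (simp add: ratfun_const_hom)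
next
  case False
  then have "ratfun_const c * ratfun_const (inverse c) = (1 :: 'v::{finite,linorder} ratfun)"
    by (simp add: ratfun_const_hom flip: ratfun_const_hom(4))
  then show ?thesis by (simp add: inverse_unique)
qed

lemma ratfun_const_powi: "ratfun_const (c powi k) = (ratfun_const c powi k :: 'v::{finite,linorder} ratfun)"
proof -
  have *: "ratfun_const (c ^ n) = (ratfun_const c ^ n :: 'v::{finite,linorder} ratfun)" for c n
    by (induction n) (simp_all add: ratfun_const_hom)
  show ?thesis by (simp add: power_int_def * ratfun_const_inverse)
qed

lemma ratfun_const_prod: "ratfun_const (prod f S) = (\<Prod>i\<in>S. ratfun_const (f i) :: 'v::{finite,linorder} ratfun)"
  by (induction S rule: infinite_finite_induct) (simp_all add: ratfun_const_hom)

lemma ratfun_eval_add: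
  assumes "ratfun_eval x r c" "ratfun_eval x s e"
  shows "ratfun_eval x (r + s) (c + e)"
proof -
  obtain a b where ab: "b \<noteq> 0" "r = Fract a b" "poly_eval x b \<noteq> 0" "c = poly_eval x a / poly_eval x b"
    using assms(1) by (auto simp: ratfun_eval_def)
  obtain a' b' where ab': "b' \<noteq> 0" "s = Fract a' b'" "poly_eval x b' \<noteq> 0" "e = poly_eval x a' / poly_eval x b'"
    using assms(2) by (auto simp: ratfun_eval_def)
  have "r + s = Fract (a * b' + a' * b) (b * b')" "b * b' \<noteq> 0" "poly_eval x (b * b') \<noteq> 0"
    "c + e = poly_eval x (a * b' + a' * b) / poly_eval x (b * b')"
    using ab ab' by (simp_all add: add_frac_eq)
  then show ?thesis
    unfolding ratfun_eval_def by blast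
qed

lemma ratfun_eval_mult:
  assumes "ratfun_eval x r c" "ratfun_eval x s e"
  shows "ratfun_eval x (r * s) (c * e)"
proof -
  obtain a b where ab: "b \<noteq> 0" "r = Fract a b" "poly_eval x b \<noteq> 0" "c = poly_eval x a / poly_eval x b"
    using assms(1) by (auto simp: ratfun_eval_def)
  obtain a' b' where ab': "b' \<noteq> 0" "s = Fract a' b'" "poly_eval x b' \<noteq> 0" "e = poly_eval x a' / poly_eval x b'"
    using assms(2) by (auto simp: ratfun_eval_def)
  show ?thesis
    unfolding ratfun_eval_def using ab ab'
    by (intro exI[of _ "a * a'"] exI[of _ "b * b'"]) simp
qed

lemma ratfun_eval_inverse:
  assumes "ratfun_eval x r c" "c \<noteq> 0"
  shows "ratfun_eval x (inverse r) (inverse c)"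
proof -
  obtain a b where ab: "b \<noteq> 0" "r = Fract a b" "poly_eval x b \<noteq> 0" "c = poly_eval x a / poly_eval x b"
    using assms(1) by (auto simp: ratfun_eval_def)
  then have "poly_eval x a \<noteq> 0" using assms(2) by auto
  moreover from this have "a \<noteq> 0" by auto
  ultimately show ?thesis
    unfolding ratfun_eval_def using ab
    by (intro exI[of _ b] exI[of _ a]) simp
qed

lemma ratfun_eval_divide:
  "ratfun_eval x r c \<Longrightarrow> ratfun_eval x s e \<Longrightarrow> e \<noteq> 0 \<Longrightarrow> ratfun_eval x (r / s) (c / e)"
  unfolding divide_inverse by (intro ratfun_eval_mult ratfun_eval_inverse)

lemma ratfun_eval_one: "ratfun_eval x 1 1"
  using ratfun_eval_const[of x 1] by (simp add: ratfun_const_hom)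

lemma ratfun_eval_power: "ratfun_eval x r c \<Longrightarrow> ratfun_eval x (r ^ k) (c ^ k)"
  by (induction k) (simp_all add: ratfun_eval_one ratfun_eval_mult)

lemma ratfun_eval_powi: "ratfun_eval x r c \<Longrightarrow> c \<noteq> 0 \<Longrightarrow> ratfun_eval x (r powi k) (c powi k)"
  by (simp add: power_int_def ratfun_eval_power ratfun_eval_inverse)

lemma ratfun_eval_sum:
  "(\<And>i. i \<in> S \<Longrightarrow> ratfun_eval x (f i) (g i)) \<Longrightarrow> ratfun_eval x (sum f S) (sum g S)"
proof (induction S rule: infinite_finite_induct)
  case (insert i S)
  then show ?case by (simp add: ratfun_eval_add)
qed (use ratfun_eval_const[of x 0] in \<open>simp_all add: ratfun_const_hom\<close>)

lemma ratfun_eval_prod: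
  "(\<And>i. i \<in> S \<Longrightarrow> ratfun_eval x (f i) (g i)) \<Longrightarrow> ratfun_eval x (prod f S) (prod g S)"
proof (induction S rule: infinite_finite_induct)
  case (insert i S)
  then show ?case by (simp add: ratfun_eval_mult)
qed (simp_all add: ratfun_eval_one)

lemma ratfun_eval_insertion:
  assumes "\<And>v. ratfun_eval x (r v) (y v)"
  shows "ratfun_eval x (insertion ratfun_const r p) (poly_eval y p)"
  unfolding insertion_def poly_eval_def id_apply
  by (intro ratfun_eval_sum ratfun_eval_mult ratfun_eval_const ratfun_eval_prod ratfun_eval_power assms)

definition monomial :: "('v::finite \<Rightarrow> int) \<Rightarrow> ('v \<Rightarrow> complex) \<Rightarrow> complex" where
  "monomial m x = (\<Prod>v\<in>UNIV. x v powi m v)"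

lemma ratfun_eval_rational_monomial:
  "(\<And>v. x v \<noteq> 0) \<Longrightarrow> ratfun_eval x (rational_monomial m) (monomial m x)"
  unfolding rational_monomial_def monomial_def
  by (intro ratfun_eval_prod ratfun_eval_powi ratfun_eval_var)

lemma scale_vars_nonzero:
  assumes "\<And>v. t v \<noteq> 0" "p \<noteq> 0"
  shows "scale_vars t p \<noteq> 0"
  using scale_vars_inverse[of t p] assms by auto

lemma scale_vars_one [simp]: "scale_vars t 1 = 1"
  using scale_vars_single[of t 0 1] by simp

lemma scale_vars_Const [simp]: "scale_vars t (Const c) = Const c"
  by (simp add: Const_def scale_vars_single)

lemma scale_vars_Var: "scale_vars t (Var v) = Const (t v) * Var v"
proof -
  have "(\<Prod>w\<in>UNIV. t w ^ Poly_Mapping.lookup (Poly_Mapping.single v 1) w) =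
      (\<Prod>w\<in>UNIV. if w = v then t w else 1)"
    by (intro prod.cong) (auto simp: lookup_single when_def)
  then show ?thesis
    by (simp add: Var_def scale_vars_single Const_def mult_single)
qed

lemma scale_vars_sum: "scale_vars t (sum f S) = (\<Sum>i\<in>S. scale_vars t (f i))"
  by (induction S rule: infinite_finite_induct) (simp_all add: scale_vars_add)

lemma scale_vars_scale_vars: "scale_vars s (scale_vars t p) = scale_vars (\<lambda>v. s v * t v) p"
  by (induction p rule: mpoly_induct)
    (simp_all add: scale_vars_add scale_vars_single power_mult_distrib prod.distrib mult_ac)

context
  fixes t :: "'v::{finite,linorder} \<Rightarrow> complex"
  assumes t: "\<And>v. t v \<noteq> 0"
begin

lemma scale_ratfun_of_mpoly: "scale_ratfun t (of_mpoly p) = of_mpoly (scale_vars t p)"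
  by (simp add: of_mpoly_def scale_ratfun_Fract t)

lemma scale_ratfun_add: "scale_ratfun t (r + s) = scale_ratfun t r + scale_ratfun t s"
proof -
  obtain a b c d where "r = Fract a b" "b \<noteq> 0" "s = Fract c d" "d \<noteq> 0"
    by (metis Fract_cases)
  then show ?thesis
    by (simp add: scale_ratfun_Fract t scale_vars_nonzero scale_vars_add scale_vars_mult)
qed

lemma scale_ratfun_mult: "scale_ratfun t (r * s) = scale_ratfun t r * scale_ratfun t s"
proof -
  obtain a b c d where "r = Fract a b" "b \<noteq> 0" "s = Fract c d" "d \<noteq> 0"
    by (metis Fract_cases)
  then show ?thesis
    by (simp add: scale_ratfun_Fract t scale_vars_mult)
qed

lemma scale_ratfun_0: "scale_ratfun t 0 = 0"
  using scale_ratfun_Fract[of t 1 0] by (simp add: t Zero_fract_def)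

lemma scale_ratfun_1: "scale_ratfun t 1 = 1"
  using scale_ratfun_Fract[of t 1 1] by (simp add: t One_fract_def)

lemma scale_ratfun_inverse: "scale_ratfun t (inverse r) = inverse (scale_ratfun t r)"
proof (cases "r = 0")
  case True
  then show ?thesis by (simp add: scale_ratfun_0)
next
  case False
  then have "scale_ratfun t r * scale_ratfun t (inverse r) = 1"
    by (simp add: scale_ratfun_1 flip: scale_ratfun_mult)
  then show ?thesis by (simp add: inverse_unique)
qed

lemma scale_ratfun_power: "scale_ratfun t (r ^ k) = scale_ratfun t r ^ k"
  by (induction k) (simp_all add: scale_ratfun_1 scale_ratfun_mult)

lemma scale_ratfun_powi: "scale_ratfun t (r powi k) = scale_ratfun t r powi k"
  by (simp add: power_int_def scale_ratfun_power scale_ratfun_inverse)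

lemma scale_ratfun_prod: "scale_ratfun t (prod f S) = (\<Prod>i\<in>S. scale_ratfun t (f i))"
  by (induction S rule: infinite_finite_induct) (simp_all add: scale_ratfun_1 scale_ratfun_mult)

lemma scale_ratfun_const: "scale_ratfun t (ratfun_const c) = ratfun_const c"
  by (simp add: ratfun_const_def scale_ratfun_of_mpoly)

text \<open>Monomials are eigenvectors of scaling. The eigenvalue is the monomial evaluated at
  \<open>t\<close>, so a monomial restricted to a group of such \<open>t\<close> is a
  character.\<close>

lemma scale_ratfun_rational_monomial:
  "scale_ratfun t (rational_monomial m) = ratfun_const (monomial m t) * rational_monomial m"
proof -
  have "scale_ratfun t (ratfun_var v) = ratfun_const (t v) * ratfun_var v" for v
    by (simp add: ratfun_var_def ratfun_const_def scale_ratfun_of_mpoly scale_vars_Var)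
      (simp add: of_mpoly_def)
  then show ?thesis
    by (simp add: rational_monomial_def monomial_def scale_ratfun_prod scale_ratfun_powi
        power_int_mult_distrib prod.distrib ratfun_const_prod ratfun_const_powi)
qed

text \<open>Scaling respects the field operations and fixes the constants. As \<open>t\<close> may
  be any vector of nonzero entries, this applies to a kernel element before it is known to lie in
  the group.\<close>

lemma scale_ratfun_adjoin_fixed:
  assumes "r \<in> adjoin S" "\<And>s. s \<in> S \<Longrightarrow> scale_ratfun t s = s"
  shows "scale_ratfun t r = r"
  using assms(1)
  by induction (simp_all add: assms(2) scale_ratfun_const scale_ratfun_add scale_ratfun_mult scale_ratfun_inverse)

end

section \<open>Laurent polynomials and torus quotients\<close>

lemma powi_sum: "x \<noteq> 0 \<Longrightarrow> (x::complex) powi (sum f S) = (\<Prod>i\<in>S. x powi f i)"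
  by (induction S rule: infinite_finite_induct) (simp_all add: power_int_add)

lemma prod_powi: "(prod f S :: complex) powi k = (\<Prod>i\<in>S. f i powi k)"
  by (induction S rule: infinite_finite_induct) (simp_all add: power_int_mult_distrib)

abbreviation torus :: "('v \<Rightarrow> complex) set" where
  "torus \<equiv> {x. \<forall>v. x v \<noteq> 0}"

lemma monomial_nonzero: "x \<in> torus \<Longrightarrow> monomial m x \<noteq> 0"
  by (simp add: monomial_def)

lemma monomial_add:
  "x \<in> torus \<Longrightarrow> monomial (\<lambda>v. m v + m' v) x = monomial m x * monomial m' x"
  by (simp add: monomial_def power_int_add prod.distrib)

lemma monomial_zero: "monomial (\<lambda>v. 0) x = 1"
  by (simp add: monomial_def)

lemma monomial_times: "monomial m (\<lambda>v. s v * x v) = monomial m s * monomial m x"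
  by (simp add: monomial_def power_int_mult_distrib prod.distrib)

lemma monomial_one: "monomial m (\<lambda>v. 1) = 1"
  by (simp add: monomial_def)

lemma monomial_exp: "monomial m (\<lambda>v. exp (z v)) = exp (\<Sum>v\<in>UNIV. of_int (m v) * z v)"
  by (simp add: monomial_def exp_power_int exp_sum)

lemma monomial_monomial:
  assumes "x \<in> torus"
  shows "monomial m (\<lambda>i. monomial (\<alpha> i) x) = monomial (\<lambda>v. \<Sum>i\<in>UNIV. m i * \<alpha> i v) x"
proof -
  have "monomial m (\<lambda>i. monomial (\<alpha> i) x) = (\<Prod>i\<in>UNIV. \<Prod>v\<in>UNIV. x v powi (m i * \<alpha> i v))"
    by (simp add: monomial_def prod_powi flip: power_int_mult) (simp add: mult.commute)
  also have "\<dots> = (\<Prod>v\<in>UNIV. \<Prod>i\<in>UNIV. x v powi (m i * \<alpha> i v))"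
    by (rule prod.swap)
  also have "\<dots> = monomial (\<lambda>v. \<Sum>i\<in>UNIV. m i * \<alpha> i v) x"
    using assms by (simp add: monomial_def powi_sum)
  finally show ?thesis .
qed

text \<open>The rule \<open>cong\<close> forgets values off the torus: at a coordinate 0 a negative
  \<open>powi\<close> takes the default value 0 and the exponent laws fail, so products and
  substitutions of monomials are monomials only on the torus.\<close>

inductive laurent :: "(('v::finite \<Rightarrow> complex) \<Rightarrow> complex) \<Rightarrow> bool" where
  monomial: "laurent (\<lambda>x. c * monomial m x)"
| add: "laurent \<phi> \<Longrightarrow> laurent \<psi> \<Longrightarrow> laurent (\<lambda>x. \<phi> x + \<psi> x)"
| cong: "laurent \<phi> \<Longrightarrow> (\<And>x. x \<in> torus \<Longrightarrow> \<psi> x = \<phi> x) \<Longrightarrow> laurent \<psi>"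

lemma laurent_const: "laurent (\<lambda>x. c)"
  using laurent.monomial[of c "\<lambda>v. 0"] by (simp add: monomial_zero)

lemma laurent_mult:
  assumes "laurent \<phi>" "laurent \<psi>"
  shows "laurent (\<lambda>x. \<phi> x * \<psi> x)"
  using assms(1)
proof induction
  case (monomial c m)
  from assms(2) show ?case
  proof induction
    case (monomial c' m')
    show ?case
      by (rule laurent.cong[OF laurent.monomial[of "c * c'" "\<lambda>v. m v + m' v"]])
        (simp add: monomial_add)
  next
    case (add \<phi> \<psi>)
    then show ?case by (simp add: distrib_left laurent.add)
  next
    case (cong \<phi> \<psi>)
    show ?case by (rule laurent.cong[OF cong.IH]) (simp add: cong.hyps)
  qed
next
  case (add \<phi> \<psi>)
  then show ?case by (simp add: distrib_right laurent.add)
next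
  case (cong \<phi>' \<psi>')
  show ?case by (rule laurent.cong[OF cong.IH]) (simp add: cong.hyps)
qed

lemma laurent_poly: "laurent (\<lambda>x. poly_eval x p)"
proof (induction p rule: mpoly_induct)
  case zero
  then show ?case by (simp add: laurent_const)
next
  case (add p m c)
  have "laurent (\<lambda>x. poly_eval x (Poly_Mapping.single m c))"
    using laurent.monomial[of c "\<lambda>v. int (Poly_Mapping.lookup m v)"]
    by (simp add: poly_eval_single monomial_def)
  with add show ?case by (simp add: laurent.add)
qed

lemma laurent_monomial_map:
  "laurent \<phi> \<Longrightarrow> laurent (\<lambda>x. \<phi> (\<lambda>i. monomial (\<alpha> i) x))"
proof (induction rule: laurent.induct)
  case (monomial c m)
  show ?case
    by (rule laurent.cong[OF laurent.monomial[of c "\<lambda>v. \<Sum>i\<in>UNIV. m i * \<alpha> i v"]])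
      (simp add: monomial_monomial)
next
  case (add \<phi> \<psi>)
  then show ?case by (simp add: laurent.add)
next
  case (cong \<phi> \<psi>)
  show ?case
    by (rule laurent.cong[OF cong.IH]) (simp add: cong.hyps monomial_nonzero)
qed

text \<open>
  Openness is built into regularity: \<open>regular_on A W (\<lambda>y. 0)\<close> with \<open>W \<subseteq> A\<close> means that \<open>W\<close> is open in \<open>A\<close>.
\<close>

definition regular_on ::
  "('v::finite \<Rightarrow> complex) set \<Rightarrow> ('v \<Rightarrow> complex) set \<Rightarrow> (('v \<Rightarrow> complex) \<Rightarrow> complex) \<Rightarrow> bool" where
  "regular_on A W h \<longleftrightarrow> (\<forall>y\<in>W. \<exists>a b. laurent a \<and> laurent b \<and> b y \<noteq> 0 \<and>
     (\<forall>z\<in>A. b z \<noteq> 0 \<longrightarrow> z \<in> W \<and> h z = a z / b z))"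

lemma regular_on_cong:
  assumes "regular_on A W h" "\<And>z. z \<in> W \<Longrightarrow> h z = h' z"
  shows "regular_on A W h'"
  using assms unfolding regular_on_def by metis

section \<open>Quotient of the torus by a finite subgroup\<close>

text \<open>Group elements are vectors of diagonal entries under pointwise multiplication, hence
  points of the torus themselves, and monomials can be evaluated at them.\<close>

locale finite_torus_subgroup =
  fixes H :: "('n::finite \<Rightarrow> complex) set"
  assumes finite_H: "finite H"
    and H_torus: "H \<subseteq> torus"
    and one_H: "(\<lambda>v. 1) \<in> H"
    and mult_H: "s \<in> H \<Longrightarrow> t \<in> H \<Longrightarrow> (\<lambda>v. s v * t v) \<in> H"
    and inverse_H: "s \<in> H \<Longrightarrow> (\<lambda>v. inverse (s v)) \<in> H"
begin

lemma bij_betw_H: "s \<in> H \<Longrightarrow> bij_betw (\<lambda>t v. s v * t v) H H"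
proof (rule bij_betw_byWitness[where f' = "\<lambda>t v. inverse (s v) * t v"])
  assume s: "s \<in> H"
  then have "s v \<noteq> 0" for v using H_torus by auto
  then show "\<forall>a\<in>H. (\<lambda>v. inverse (s v) * (s v * a v)) = a" "\<forall>a\<in>H. (\<lambda>v. s v * (inverse (s v) * a v)) = a"
    by (simp_all flip: mult.assoc)
  show "(\<lambda>t v. s v * t v) ` H \<subseteq> H" "(\<lambda>t v. inverse (s v) * t v) ` H \<subseteq> H"
    using mult_H s inverse_H[OF s] by auto
qed

lemma H_action_torus: "s \<in> H \<Longrightarrow> x \<in> torus \<Longrightarrow> (\<lambda>v. s v * x v) \<in> torus"
  using H_torus by auto

end

text \<open>\<open>kernel\<close> is all that remains of the equality with the invariant field. It
  says that the group is the fibre over the unit point, and by translation every fibre becomes an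
  orbit.\<close>

locale torus_quotient = finite_torus_subgroup H
  for H :: "('n::finite \<Rightarrow> complex) set" +
  fixes \<alpha> :: "'n \<Rightarrow> 'n \<Rightarrow> int"
  assumes kernel: "t \<in> torus \<Longrightarrow> t \<in> H \<longleftrightarrow> (\<forall>i. monomial (\<alpha> i) t = 1)"
begin

definition u :: "('n \<Rightarrow> complex) \<Rightarrow> 'n \<Rightarrow> complex" where
  "u x = (\<lambda>i. monomial (\<alpha> i) x)"

lemma u_torus: "x \<in> torus \<Longrightarrow> u x \<in> torus"
  by (simp add: u_def monomial_nonzero)

lemma u_H: "s \<in> H \<Longrightarrow> u (\<lambda>v. s v * x v) = u x"
  using kernel[of s] H_torus by (auto simp: u_def monomial_times)

lemma u_eq_iff:
  assumes "x \<in> torus" "y \<in> torus"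
  shows "u x = u y \<longleftrightarrow> (\<exists>s\<in>H. y = (\<lambda>v. s v * x v))"
proof
  assume eq: "u x = u y"
  define s where "s = (\<lambda>v. y v / x v)"
  have s: "s \<in> torus" "y = (\<lambda>v. s v * x v)" using assms by (auto simp: s_def)
  have "monomial (\<alpha> i) s * monomial (\<alpha> i) x = monomial (\<alpha> i) x" for i
    using eq s(2) by (metis monomial_times u_def)
  then have "s \<in> H" using kernel s(1) monomial_nonzero[OF assms(1)] by simp
  with s(2) show "\<exists>s\<in>H. y = (\<lambda>v. s v * x v)" by blast
qed (auto simp: u_H)

definition exponent_matrix :: "complex^'n^'n" where
  "exponent_matrix = (\<chi> i v. of_int (\<alpha> i v))"

lemma u_exp: "u (\<lambda>v. exp (c * X $ v)) = (\<lambda>i. exp (c * (exponent_matrix *v X) $ i))"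
  by (simp add: u_def monomial_exp exponent_matrix_def matrix_vector_mult_def sum_distrib_left mult_ac)

text \<open>A complex kernel vector would give a one-parameter subgroup of the finite group \<open>H\<close>.\<close>

lemma exponent_matrix_kernel:
  assumes "exponent_matrix *v X = 0"
  shows "X = 0"
proof (rule ccontr)
  assume "X \<noteq> 0"
  then obtain w where w: "X $ w \<noteq> 0" by (auto simp: vec_eq_iff)
  have "(\<lambda>v. exp (c * X $ v)) \<in> H" for c
    using kernel fun_cong[OF u_exp[of c X]] assms by (simp add: u_def)
  then have *: "exp (c * X $ w) \<in> (\<lambda>s. s w) ` H" for c
    by (rule rev_image_eqI) simp
  \<comment> \<open>The parameter \<open>Ln z / X $ w\<close> reaches an arbitrary nonzero
    \<open>z\<close>, so the finitely many \<open>w\<close>-coordinates of \<open>H\<close> would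
    exhaust the nonzero complex numbers.\<close>
  have "z \<in> (\<lambda>s. s w) ` H" if "z \<noteq> 0" for z
    using *[of "Ln z / X $ w"] w that by simp
  then have "UNIV \<subseteq> insert 0 ((\<lambda>s. s w) ` H)" by blast
  then have "finite (UNIV :: complex set)"
    using finite_H by (meson finite.insertI finite_imageI finite_subset)
  then show False by (simp add: infinite_UNIV_char_0)
qed

lemma exponent_matrix_inverse:
  obtains N where "exponent_matrix ** N = mat 1" "N ** exponent_matrix = mat 1"
proof -
  have "inj ((*v) exponent_matrix)"
  proof (rule injI)
    fix X Y assume "exponent_matrix *v X = exponent_matrix *v Y"
    then have "exponent_matrix *v (X - Y) = 0" by (simp add: matrix_vector_mult_diff_distrib)
    then show "X = Y" using exponent_matrix_kernel by force
  qed
  then obtain N where "N ** exponent_matrix = mat 1"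
    unfolding matrix_left_invertible_injective[symmetric] by blast
  then show thesis using that matrix_left_right_inverse by blast
qed

text \<open>In logarithmic coordinates the monomial map is the exponent matrix, which is invertible
  over the complex numbers. The branch of the logarithm is immaterial, since only
  \<open>exp (Ln y) = y\<close> for nonzero \<open>y\<close> matters.\<close>

lemma u_surj:
  assumes "y \<in> torus"
  obtains x where "x \<in> torus" "u x = y"
proof -
  obtain N where N: "exponent_matrix ** N = mat 1" by (rule exponent_matrix_inverse)
  define X where "X = N *v (\<chi> i. Ln (y i))"
  have "exponent_matrix *v X = (\<chi> i. Ln (y i))"
    by (simp add: X_def matrix_vector_mul_assoc N)
  then have "u (\<lambda>v. exp (1 * X $ v)) = y"
    unfolding u_exp using assms by simp
  then show thesis by (intro that[of "\<lambda>v. exp (1 * X $ v)"]) simp_all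
qed

text \<open>
  The coefficients \<open>c\<close> of \<open>m\<close> in terms of the rows of the matrix are integers because the columns
  of \<open>2 \<pi> i\<close> times the inverse matrix exponentiate to elements of \<open>H\<close>.
\<close>

lemma invariant_monomial:
  assumes "\<And>s. s \<in> H \<Longrightarrow> monomial m s = 1"
  obtains c :: "'n \<Rightarrow> int" where "m = (\<lambda>v. \<Sum>i\<in>UNIV. c i * \<alpha> i v)"
proof -
  obtain N where N: "exponent_matrix ** N = mat 1" "N ** exponent_matrix = mat 1"
    by (rule exponent_matrix_inverse)
  \<comment> \<open>The row vector \<open>m\<close> times the inverse matrix: the only possible
    coefficients. Once they are integers, multiplying back by the exponent matrix recovers
    \<open>m\<close>.\<close>
  define e where "e = (\<lambda>j. \<Sum>v\<in>UNIV. of_int (m v) * N $ v $ j)"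
  have "\<exists>k. e j = of_int k" for j
  proof -
    define s where "s = (\<lambda>v. exp (2 * pi * \<i> * column j N $ v))"
    have "exponent_matrix *v column j N = (\<chi> i. if i = j then 1 else 0)"
      using N(1) by (simp add: vec_eq_iff matrix_matrix_mult_def matrix_vector_mult_def column_def mat_def)
    then have "u s i = 1" for i
      unfolding s_def u_exp by simp
    then have "s \<in> H" using kernel[of s] by (simp add: u_def s_def)
    then have "monomial m s = 1" by (rule assms)
    then have "exp (2 * pi * \<i> * e j) = 1"
      by (simp add: s_def monomial_exp e_def column_def sum_distrib_left mult_ac)
    then obtain n :: int where "2 * pi * Re (e j) = of_int (2 * n) * pi" "Im (e j) = 0"
      unfolding exp_eq_1 by auto
    then show ?thesis by (intro exI[of _ n]) (simp add: complex_eq_iff)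
  qed
  then obtain c where c: "\<And>j. e j = of_int (c j)" by metis
  have "of_int (m w) = (\<Sum>i\<in>UNIV. of_int (c i) * of_int (\<alpha> i w) :: complex)" for w
  proof -
    have "(\<Sum>i\<in>UNIV. e i * of_int (\<alpha> i w)) =
        (\<Sum>i\<in>UNIV. \<Sum>v\<in>UNIV. of_int (m v) * (N $ v $ i * of_int (\<alpha> i w)))"
      by (simp add: e_def sum_distrib_right mult.assoc)
    also have "\<dots> = (\<Sum>v\<in>UNIV. of_int (m v) * (N ** exponent_matrix) $ v $ w)"
      by (subst sum.swap) (simp add: matrix_matrix_mult_def exponent_matrix_def sum_distrib_left)
    also have "\<dots> = (\<Sum>v\<in>UNIV. if v = w then of_int (m v) else 0)"
      unfolding N(2) by (intro sum.cong) (auto simp: mat_def)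
    finally show ?thesis by (simp add: c)
  qed
  then have "of_int (m w) = (of_int (\<Sum>i\<in>UNIV. c i * \<alpha> i w) :: complex)" for w
    by simp
  then have "m = (\<lambda>v. \<Sum>i\<in>UNIV. c i * \<alpha> i v)"
    unfolding of_int_eq_iff by blast
  then show thesis by (rule that)
qed

text \<open>Orthogonality of characters: translating the sum \<open>S\<close> by \<open>s\<close>
  multiplies it by \<open>monomial m s\<close>, so either \<open>S\<close> is 0 or the character is
  trivial, and then the monomial is one in the \<open>u\<close> coordinates. The sum is not divided
  by the order of \<open>H\<close>, as only quotients of two such sums are formed.\<close>

lemma averaged_laurent:
  "laurent \<phi> \<Longrightarrow> \<exists>\<psi>. laurent \<psi> \<and> (\<forall>x\<in>torus. (\<Sum>s\<in>H. \<phi> (\<lambda>v. s v * x v)) = \<psi> (u x))"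
proof (induction rule: laurent.induct)
  case (monomial c m)
  define S where "S = (\<Sum>s\<in>H. monomial m s)"
  have avg: "(\<Sum>s\<in>H. c * monomial m (\<lambda>v. s v * x v)) = c * S * monomial m x" for x
    by (simp add: S_def monomial_times sum_distrib_left sum_distrib_right mult_ac)
  show ?case
  proof (cases "S = 0")
    case True
    then show ?thesis
      unfolding avg by (intro exI[of _ "\<lambda>x. 0"]) (simp add: laurent_const)
  next
    case False
    have "monomial m s = 1" if s: "s \<in> H" for s
    proof -
      have "monomial m s * S = (\<Sum>t\<in>H. monomial m (\<lambda>v. s v * t v))"
        by (simp add: S_def monomial_times sum_distrib_left)
      also have "\<dots> = S"
        unfolding S_def by (rule sum.reindex_bij_betw[OF bij_betw_H[OF s]])
      finally show ?thesis using False by simp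
    qed
    then obtain e where e: "m = (\<lambda>v. \<Sum>i\<in>UNIV. e i * \<alpha> i v)"
      by (rule invariant_monomial)
    show ?thesis
      unfolding avg
      by (intro exI[of _ "\<lambda>x. c * S * monomial e x"])
        (simp add: laurent.monomial e u_def monomial_monomial)
  qed
next
  case (add \<phi> \<psi>)
  then obtain \<phi>' \<psi>' where "laurent \<phi>'" "\<forall>x\<in>torus. (\<Sum>s\<in>H. \<phi> (\<lambda>v. s v * x v)) = \<phi>' (u x)"
    "laurent \<psi>'" "\<forall>x\<in>torus. (\<Sum>s\<in>H. \<psi> (\<lambda>v. s v * x v)) = \<psi>' (u x)" by blast
  then show ?case
    by (intro exI[of _ "\<lambda>x. \<phi>' x + \<psi>' x"]) (simp add: laurent.add sum.distrib)
next
  case (cong \<phi> \<psi>)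
  have "(\<Sum>s\<in>H. \<psi> (\<lambda>v. s v * x v)) = (\<Sum>s\<in>H. \<phi> (\<lambda>v. s v * x v))" if "x \<in> torus" for x
    using that H_torus by (intro sum.cong cong.hyps) auto
  with cong.IH show ?case by simp
qed

text \<open>The group acts freely on the torus, so \<open>x\<close> differs from all its translates
  by elements other than 1. In a sum over the orbit of \<open>x\<close> the factor \<open>e\<close>
  leaves only the term at \<open>x\<close>.\<close>

lemma exists_separating_laurent:
  assumes x: "x \<in> torus"
  obtains e where "laurent e" "e x = 1" "\<And>s. s \<in> H \<Longrightarrow> s \<noteq> (\<lambda>v. 1) \<Longrightarrow> e (\<lambda>v. s v * x v) = 0"
proof -
  let ?B = "(\<lambda>s v. s v * x v) ` (H - {\<lambda>v. 1})"
  have "x \<notin> ?B"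
  proof
    assume "x \<in> ?B"
    then obtain s where s: "s \<noteq> (\<lambda>v. 1)" "x = (\<lambda>v. s v * x v)" by blast
    then have "x v = s v * x v" for v by metis
    with x s(1) show False by (auto simp: fun_eq_iff)
  qed
  then obtain g where "poly_eval x g = 1" "\<And>b. b \<in> ?B \<Longrightarrow> poly_eval b g = 0"
    using exists_separating_polynomial[of ?B x] finite_H by auto
  then show thesis by (intro that[of "\<lambda>x. poly_eval x g"] laurent_poly) auto
qed

lemma regular_on_pullback:
  assumes AB: "A \<subseteq> torus" "\<And>x. x \<in> torus \<Longrightarrow> x \<in> A \<longleftrightarrow> u x \<in> B"
    and W: "regular_on B W h"
  shows "regular_on A {x \<in> A. u x \<in> W} (\<lambda>x. h (u x))"
  unfolding regular_on_def
proof
  fix x assume x: "x \<in> {x \<in> A. u x \<in> W}"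
  then obtain a b where ab: "laurent a" "laurent b" "b (u x) \<noteq> 0"
    "\<forall>z\<in>B. b z \<noteq> 0 \<longrightarrow> z \<in> W \<and> h z = a z / b z"
    using W unfolding regular_on_def by blast
  have "u z \<in> B" if "z \<in> A" for z using AB that by blast
  with ab show "\<exists>a b. laurent a \<and> laurent b \<and> b x \<noteq> 0 \<and>
      (\<forall>z\<in>A. b z \<noteq> 0 \<longrightarrow> z \<in> {x \<in> A. u x \<in> W} \<and> h (u z) = a z / b z)"
    by (intro exI[of _ "\<lambda>x. a (u x)"] exI[of _ "\<lambda>x. b (u x)"])
      (simp add: u_def laurent_monomial_map)
qed

text \<open>
  Numerator and denominator are made invariant by averaging, after multiplying both with a function that
  separates \<open>x\<close> from the rest of its orbit, so that the averaged denominator does not vanish at \<open>x\<close>.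
\<close>

lemma regular_on_descend:
  assumes AB: "A \<subseteq> torus" "B \<subseteq> torus" "\<And>x. x \<in> torus \<Longrightarrow> x \<in> A \<longleftrightarrow> u x \<in> B"
    and "W \<subseteq> B"
    and W: "regular_on A {x \<in> A. u x \<in> W} (\<lambda>x. h (u x))"
  shows "regular_on B W h"
  unfolding regular_on_def
proof
  fix y assume y: "y \<in> W"
  then have "y \<in> torus" using assms by blast
  then obtain x where x: "x \<in> torus" "u x = y" by (rule u_surj)
  then have xA: "x \<in> A" using AB(3) y \<open>W \<subseteq> B\<close> by blast
  then obtain a b where ab: "laurent a" "laurent b" "b x \<noteq> 0"
    "\<And>z. z \<in> A \<Longrightarrow> b z \<noteq> 0 \<Longrightarrow> u z \<in> W \<and> h (u z) = a z / b z"
    using W x y unfolding regular_on_def by blast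
  obtain e where e: "laurent e" "e x = 1" "\<And>s. s \<in> H \<Longrightarrow> s \<noteq> (\<lambda>v. 1) \<Longrightarrow> e (\<lambda>v. s v * x v) = 0"
    using exists_separating_laurent[OF x(1)] by blast
  \<comment> \<open>The additional factor \<open>b z\<close> in both functions makes
    \<open>a'\<close> vanish wherever \<open>b\<close> does. Thus
    \<open>h (u z) * b' z = a' z\<close> holds on all of \<open>A\<close>, also where the fraction
    says nothing about \<open>h\<close>, and can be summed over orbits.\<close>
  define a' b' where "a' = (\<lambda>z. a z * b z * e z)" and "b' = (\<lambda>z. b z * b z * e z)"
  have "laurent a'" "laurent b'"
    unfolding a'_def b'_def by (intro laurent_mult ab e)+
  then obtain a'' b'' where a'': "laurent a''" "\<And>x. x \<in> torus \<Longrightarrow> (\<Sum>s\<in>H. a' (\<lambda>v. s v * x v)) = a'' (u x)"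
    and b'': "laurent b''" "\<And>x. x \<in> torus \<Longrightarrow> (\<Sum>s\<in>H. b' (\<lambda>v. s v * x v)) = b'' (u x)"
    using averaged_laurent by meson
  have HA: "(\<lambda>v. s v * z v) \<in> A" if s: "s \<in> H" and z: "z \<in> A" for s z
  proof -
    have zt: "z \<in> torus" using z AB(1) by (rule subsetD[rotated])
    have "u z \<in> B" using z AB(3)[OF zt] by (rule iffD1[rotated])
    then show ?thesis
      unfolding AB(3)[OF H_action_torus[OF s zt]] by (simp only: u_H[OF s])
  qed
  have a'b': "h (u z) * b' z = a' z" if "z \<in> A" for z
    using ab(4)[OF that] by (cases "b z = 0") (simp_all add: a'_def b'_def)
  have "b'' y = (\<Sum>s\<in>H. b' (\<lambda>v. s v * x v))" using b''(2) x by simp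
  also have "\<dots> = (\<Sum>s\<in>H. if s = (\<lambda>v. 1) then b x * b x else 0)"
    using e by (intro sum.cong) (auto simp: b'_def)
  also have "\<dots> = b x * b x" using finite_H one_H by simp
  finally have "b'' y \<noteq> 0" using ab(3) by simp
  moreover have "w \<in> W \<and> h w = a'' w / b'' w" if w: "w \<in> B" "b'' w \<noteq> 0" for w
  proof -
    obtain z where z: "z \<in> torus" "u z = w" using u_surj w(1) AB(2) by blast
    then have zA: "z \<in> A" using AB(3) w(1) by blast
    \<comment> \<open>The value \<open>h w\<close> is constant along the orbit of \<open>z\<close>,
      so it moves inside the sum and the identity applies termwise.\<close>
    have "h w * b'' w = (\<Sum>s\<in>H. h w * b' (\<lambda>v. s v * z v))"
      unfolding b''(2)[OF z(1), unfolded z(2), symmetric] by (rule sum_distrib_left)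
    also have "\<dots> = (\<Sum>s\<in>H. a' (\<lambda>v. s v * z v))"
    proof (rule sum.cong)
      fix s assume s: "s \<in> H"
      then show "h w * b' (\<lambda>v. s v * z v) = a' (\<lambda>v. s v * z v)"
        using a'b'[OF HA[OF s zA]] by (simp only: u_H[OF s] z(2))
    qed simp
    also have "\<dots> = a'' w" using a''(2)[OF z(1)] z(2) by simp
    finally have "h w = a'' w / b'' w" using w(2) by (simp add: field_simps)
    \<comment> \<open>A nonzero sum has a nonzero term. At that point of the orbit \<open>b\<close>
      does not vanish, which places its image \<open>w\<close> in \<open>W\<close>.\<close>
    moreover obtain s where s: "s \<in> H" "b' (\<lambda>v. s v * z v) \<noteq> 0"
      using w(2) b''(2)[OF z(1)] unfolding z(2) by (metis (no_types, lifting) sum.neutral)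
    then have "u (\<lambda>v. s v * z v) \<in> W"
      using ab(4)[OF HA[OF s(1) zA]] by (auto simp: b'_def)
    then have "w \<in> W" using u_H[OF s(1)] z(2) by simp
    ultimately show ?thesis by blast
  qed
  ultimately show "\<exists>a b. laurent a \<and> laurent b \<and> b y \<noteq> 0 \<and>
      (\<forall>z\<in>B. b z \<noteq> 0 \<longrightarrow> z \<in> W \<and> h z = a z / b z)"
    using a''(1) b''(1) by blast
qed

lemma regular_on_iff:
  assumes "A \<subseteq> torus" "B \<subseteq> torus" "\<And>x. x \<in> torus \<Longrightarrow> x \<in> A \<longleftrightarrow> u x \<in> B" "W \<subseteq> B"
  shows "regular_on A {x \<in> A. u x \<in> W} (\<lambda>x. h (u x)) \<longleftrightarrow> regular_on B W h"
  using regular_on_pullback[OF assms(1,3)] regular_on_descend[OF assms] by blast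

end

section \<open>The torus in projective space\<close>

lemma homogeneous_add: "homogeneous d p \<Longrightarrow> homogeneous d q \<Longrightarrow> homogeneous d (p + q)"
  using Poly_Mapping.keys_add[of p q] by (auto simp: homogeneous_def)

lemma homogeneous_one: "homogeneous 0 1"
  by (simp add: homogeneous_def)

lemma homogeneous_Var: "homogeneous 1 (Var v)"
  by (simp add: homogeneous_def Var_def lookup_single when_def)

lemma homogeneous_prod_Var:
  "finite S \<Longrightarrow> homogeneous (card S) (\<Prod>v\<in>S. Var v)"
proof (induction S rule: finite_induct)
  case (insert v S)
  then show ?case using homogeneous_mult[OF homogeneous_Var insert.IH, of v] by simp
qed (simp add: homogeneous_one)

lemma homogeneous_power: "homogeneous d p \<Longrightarrow> homogeneous (k * d) (p ^ k)"
  by (induction k) (simp_all add: homogeneous_one homogeneous_mult)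

lemma torus_divide: "x \<in> torus \<Longrightarrow> (\<lambda>v. x (Some v) / x None) \<in> torus"
  by simp

lemma prod_option: "(\<Prod>v\<in>UNIV. f v) = f None * (\<Prod>v\<in>UNIV. f (Some v))"
  for f :: "'v::finite option \<Rightarrow> 'b::comm_monoid_mult"
  by (simp add: UNIV_option_conv prod.reindex inj_on_def comp_def)

lemma sum_option: "(\<Sum>v\<in>UNIV. f v) = f None + (\<Sum>v\<in>UNIV. f (Some v))"
  for f :: "'v::finite option \<Rightarrow> 'b::comm_monoid_add"
  by (simp add: UNIV_option_conv sum.reindex inj_on_def comp_def)

text \<open>The sum \<open>N\<close> of the absolute values of the exponents makes every exponent
  \<open>m v + N\<close>, as well as \<open>N\<close> minus the sum of \<open>m\<close> at
  \<open>None\<close>, nonnegative. A monomial in the ratios has degree 0, so the degree comes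
  entirely from the power of the product of all coordinates.\<close>

lemma monomial_homogenization:
  fixes m :: "'n::finite \<Rightarrow> int"
  shows "\<exists>N p. homogeneous (N * CARD('n option)) p \<and>
    (\<forall>x\<in>torus. poly_eval x p = c * monomial m (\<lambda>v. x (Some v) / x None) * (\<Prod>v\<in>UNIV. x v) ^ N)"
proof -
  define N where "N = nat (\<Sum>v\<in>UNIV. \<bar>m v\<bar>)"
  have N: "int N = (\<Sum>v\<in>UNIV. \<bar>m v\<bar>)" by (simp add: N_def sum_nonneg)
  have mv: "m v + int N \<ge> 0" for v
    using member_le_sum[of v UNIV "\<lambda>v. \<bar>m v\<bar>"] unfolding N by simp
  have le: "(\<Sum>v\<in>UNIV. m v) \<le> int N"
    unfolding N by (rule sum_mono) simp
  then have msum: "int N - (\<Sum>v\<in>UNIV. m v) \<ge> 0" by simp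
  define e :: "'n option \<Rightarrow> nat" where
    "e = case_option (nat (int N - (\<Sum>v\<in>UNIV. m v))) (\<lambda>v. nat (m v + int N))"
  define p where "p = Poly_Mapping.single (Abs_poly_mapping e) c"
  have lookup: "Poly_Mapping.lookup (Abs_poly_mapping e) = e"
    by (simp add: Abs_poly_mapping_inverse)
  have "int (\<Sum>v\<in>UNIV. e v) = int (N * CARD('n option))"
    by (simp add: sum_option e_def mv le sum.distrib distrib_left)
  then have "homogeneous (N * CARD('n option)) p"
    unfolding of_nat_eq_iff by (simp add: homogeneous_def p_def lookup)
  moreover have "poly_eval x p = c * monomial m (\<lambda>v. x (Some v) / x None) * (\<Prod>v\<in>UNIV. x v) ^ N"
    if x: "x \<in> torus" for x
  proof -
    have eN: "x None ^ e None = x None powi (int N - (\<Sum>v\<in>UNIV. m v))"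
      using msum by (simp add: e_def power_int_nonneg_exp)
    have eS: "x (Some v) ^ e (Some v) = x (Some v) powi (m v + int N)" for v
      using mv by (simp add: e_def power_int_nonneg_exp)
    show ?thesis
      using x
      by (simp add: p_def poly_eval_single lookup prod_option eN eS power_int_add power_int_diff
          prod.distrib monomial_def power_int_divide_distrib prod_dividef powi_sum
          power_mult_distrib prod_power_distrib)
  qed
  ultimately show ?thesis by blast
qed

lemma laurent_homogenization:
  fixes \<phi> :: "('n::finite \<Rightarrow> complex) \<Rightarrow> complex"
  assumes "laurent \<phi>"
  shows "\<exists>N p. homogeneous (N * CARD('n option)) p \<and>
    (\<forall>x\<in>torus. poly_eval x p = \<phi> (\<lambda>v. x (Some v) / x None) * (\<Prod>v\<in>UNIV. x v) ^ N)"
  using assms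
proof induction
  case (monomial c m)
  show ?case by (rule monomial_homogenization)
next
  case (add \<phi> \<psi>)
  let ?M = "\<Prod>v\<in>UNIV. Var v :: 'n option mpoly"
  have M: "homogeneous (k * CARD('n option)) (?M ^ k)" for k
    by (intro homogeneous_power homogeneous_prod_Var) simp
  obtain N p where p: "homogeneous (N * CARD('n option)) p"
    "\<forall>x\<in>torus. poly_eval x p = \<phi> (\<lambda>v. x (Some v) / x None) * (\<Prod>v\<in>UNIV. x v) ^ N"
    using add.IH by blast
  obtain N' p' where p': "homogeneous (N' * CARD('n option)) p'"
    "\<forall>x\<in>torus. poly_eval x p' = \<psi> (\<lambda>v. x (Some v) / x None) * (\<Prod>v\<in>UNIV. x v) ^ N'"
    using add.IH by blast
  \<comment> \<open>Multiplying each polynomial by the other's power of the product of the variables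
    gives both the common exponent \<open>N + N'\<close> and hence the same degree.\<close>
  have "homogeneous ((N + N') * CARD('n option)) (p * ?M ^ N' + p' * ?M ^ N)"
    using homogeneous_mult[OF p(1) M[of N']] homogeneous_mult[OF p'(1) M[of N]]
    by (intro homogeneous_add) (simp_all only: add_mult_distrib add.commute)
  then show ?case
    using p(2) p'(2)
    by (intro exI[of _ "N + N'"] exI[of _ "p * ?M ^ N' + p' * ?M ^ N"])
      (simp add: power_add algebra_simps)
next
  case (cong \<phi> \<psi>)
  then obtain N p where "homogeneous (N * CARD('n option)) p"
    "\<forall>x\<in>torus. poly_eval x p = \<phi> (\<lambda>v. x (Some v) / x None) * (\<Prod>v\<in>UNIV. x v) ^ N"
    by blast
  then show ?case
    using cong.hyps(2)[OF torus_divide] by (intro exI[of _ N] exI[of _ p]) simp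
qed

text \<open>The extra factor \<open>\<Prod>v. Var v\<close> makes \<open>q\<close> vanish outside the torus.\<close>

lemma laurent_homogenization_pair:
  fixes a b :: "('n::finite \<Rightarrow> complex) \<Rightarrow> complex"
  assumes "laurent a" "laurent b"
  obtains d p q N where "homogeneous d p" "homogeneous d q"
    "\<forall>x\<in>torus. poly_eval x p = a (\<lambda>v. x (Some v) / x None) * (\<Prod>v\<in>UNIV. x v) ^ N"
    "\<forall>x\<in>torus. poly_eval x q = b (\<lambda>v. x (Some v) / x None) * (\<Prod>v\<in>UNIV. x v) ^ N"
    "\<forall>x. poly_eval x q \<noteq> 0 \<longrightarrow> x \<in> torus"
proof -
  let ?M = "\<Prod>v\<in>UNIV. Var v :: 'n option mpoly"
  have M: "homogeneous (k * CARD('n option)) (?M ^ k)" for k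
    by (intro homogeneous_power homogeneous_prod_Var) simp
  obtain N p where p: "homogeneous (N * CARD('n option)) p"
    "\<forall>x\<in>torus. poly_eval x p = a (\<lambda>v. x (Some v) / x None) * (\<Prod>v\<in>UNIV. x v) ^ N"
    using laurent_homogenization[OF assms(1)] by blast
  obtain N' p' where p': "homogeneous (N' * CARD('n option)) p'"
    "\<forall>x\<in>torus. poly_eval x p' = b (\<lambda>v. x (Some v) / x None) * (\<Prod>v\<in>UNIV. x v) ^ N'"
    using laurent_homogenization[OF assms(2)] by blast
  show thesis
  proof (rule that)
    show "homogeneous ((N + Suc N') * CARD('n option)) (p * ?M ^ Suc N')"
      unfolding add_mult_distrib by (rule homogeneous_mult[OF p(1) M])
    have "N' + Suc N = N + Suc N'" by simp
    then show "homogeneous ((N + Suc N') * CARD('n option)) (p' * ?M ^ Suc N)"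
      using homogeneous_mult[OF p'(1) M[of "Suc N"]] by (simp only: flip: add_mult_distrib)
    show "\<forall>x\<in>torus. poly_eval x (p * ?M ^ Suc N') = a (\<lambda>v. x (Some v) / x None) * (\<Prod>v\<in>UNIV. x v) ^ (N + Suc N')"
      "\<forall>x\<in>torus. poly_eval x (p' * ?M ^ Suc N) = b (\<lambda>v. x (Some v) / x None) * (\<Prod>v\<in>UNIV. x v) ^ (N + Suc N')"
      using p(2) p'(2) by (simp_all add: power_add)
    show "\<forall>x. poly_eval x (p' * ?M ^ Suc N) \<noteq> 0 \<longrightarrow> x \<in> torus"
      by auto
  qed
qed

section \<open>Points, open sets and regular functions in the chart\<close>

definition hom_coords :: "('n::finite \<Rightarrow> complex) \<Rightarrow> complex^'n option" where
  "hom_coords y = (\<chi> v. case_option 1 y v)"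

definition proj_pt :: "('n::finite \<Rightarrow> complex) \<Rightarrow> (complex^'n option) set" where
  "proj_pt y = {c *s hom_coords y |c. c \<noteq> 0}"

lemma hom_coords_nth [simp]: "hom_coords y $ None = 1" "hom_coords y $ Some v = y v"
  by (simp_all add: hom_coords_def)

lemma nth_hom_coords: "($) (hom_coords y) = case_option 1 y"
  by (auto simp: hom_coords_def fun_eq_iff)

lemma hom_coords_in_proj_pt: "hom_coords y \<in> proj_pt y"
  by (force simp: proj_pt_def intro: exI[of _ 1])

lemma proj_pt_in_proj_points: "proj_pt y \<in> proj_points"
proof -
  have "hom_coords y \<noteq> 0" by (auto simp: vec_eq_iff intro!: exI[of _ None])
  then show ?thesis by (auto simp: proj_points_def proj_pt_def)
qed

lemma proj_pt_coords:
  assumes "x \<in> proj_pt y"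
  shows "x $ None \<noteq> 0" "(\<lambda>v. x $ Some v / x $ None) = y" "y \<in> torus \<Longrightarrow> ($) x \<in> torus"
  using assms by (auto simp: proj_pt_def fun_eq_iff split: option.split elim!: option.exhaust)
    (metis hom_coords_nth not_None_eq zero_neq_one)

lemma proj_pt_inj: "proj_pt y = proj_pt z \<longleftrightarrow> y = z"
  using proj_pt_coords(2)[of "hom_coords y" y] proj_pt_coords(2)[of "hom_coords y" z]
    hom_coords_in_proj_pt[of y] by metis

lemma proj_pt_eqI:
  assumes P: "P \<in> proj_points" "x \<in> P" "x $ None \<noteq> 0"
  shows "P = proj_pt (\<lambda>v. x $ Some v / x $ None)"
proof -
  obtain z where z: "P = {c *s z |c. c \<noteq> 0}" using P(1) by (auto simp: proj_points_def)
  then obtain c where c: "c \<noteq> 0" "x = c *s z" using P(2) by auto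
  have h: "hom_coords (\<lambda>v. x $ Some v / x $ None) = inverse (x $ None) *s x"
    using P(3) by (auto simp: vec_eq_iff hom_coords_def divide_inverse mult.commute split: option.split)
  have "a *s z \<in> proj_pt (\<lambda>v. x $ Some v / x $ None)" if "a \<noteq> 0" for a
    unfolding proj_pt_def h mem_Collect_eq using that c P(3)
    by (intro exI[of _ "a * x $ None / c"]) (simp add: vector_smult_assoc field_simps)
  moreover have "b *s (inverse (x $ None) *s x) \<in> P" if "b \<noteq> 0" for b
    unfolding z mem_Collect_eq using that c P(3)
    by (intro exI[of _ "b * inverse (x $ None) * c"]) (simp add: vector_smult_assoc)
  ultimately show ?thesis
    unfolding z proj_pt_def h by (auto simp: z)
qed

lemma eval_at_proj_pt:
  assumes "homogeneous d p" "x \<in> proj_pt y"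
  shows "eval_at p x = 0 \<longleftrightarrow> poly_eval (case_option 1 y) p = 0"
proof -
  obtain c where "c \<noteq> 0" "x = c *s hom_coords y" using assms(2) by (auto simp: proj_pt_def)
  then show ?thesis
    by (simp add: eval_at_homogeneous[OF assms(1)]) (simp add: eval_at_eq_poly_eval nth_hom_coords)
qed

definition affine_part :: "(complex^'n::finite option) set set \<Rightarrow> ('n \<Rightarrow> complex) set" where
  "affine_part V = {y \<in> torus. proj_pt y \<in> V}"

lemma openin_zariski:
  "openin zariski_topology U \<longleftrightarrow>
     (\<exists>S. (\<forall>p\<in>S. \<exists>d. homogeneous d p) \<and> U = proj_points - zero_locus S)"
  unfolding zariski_topology_def by (simp add: topology_inverse' istopology_zariski)

lemma laurent_poly_hom_coords: "laurent (\<lambda>z. poly_eval (case_option 1 z) p)"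
  using laurent_poly[of "dehomogenize p"] by (simp add: poly_eval_dehomogenize)

text \<open>The complement of a zero locus containing \<open>proj_pt y\<close> has an equation
  \<open>p\<close> that is nonzero there. Setting its last coordinate to 1 gives the Laurent
  polynomial, and its nonvanishing alone keeps a point of \<open>V\<close> in
  \<open>W\<close>.\<close>

lemma openin_laurent_neighbourhood:
  assumes "openin (subtopology zariski_topology V) W" "proj_pt y \<in> W"
  obtains \<phi> where "laurent \<phi>" "\<phi> y \<noteq> 0" "\<And>z. z \<in> affine_part V \<Longrightarrow> \<phi> z \<noteq> 0 \<Longrightarrow> proj_pt z \<in> W"
proof -
  obtain S where S: "\<forall>p\<in>S. \<exists>d. homogeneous d p" "W = (proj_points - zero_locus S) \<inter> V"
    using assms(1) unfolding openin_subtopology openin_zariski by blast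
  have *: "proj_pt z \<in> zero_locus S \<longleftrightarrow> (\<forall>p\<in>S. poly_eval (case_option 1 z) p = 0)" for z
    using S(1) eval_at_proj_pt[of _ _ _ z] hom_coords_in_proj_pt[of z]
    unfolding zero_locus_def mem_Collect_eq by (meson proj_pt_in_proj_points)
  then obtain p where p: "p \<in> S" "poly_eval (case_option 1 y) p \<noteq> 0"
    using assms(2) S(2) by blast
  show thesis
  proof (rule that)
    show "laurent (\<lambda>z. poly_eval (case_option 1 z) p)" by (rule laurent_poly_hom_coords)
    show "proj_pt z \<in> W" if "z \<in> affine_part V" "poly_eval (case_option 1 z) p \<noteq> 0" for z
      using that p(1) * unfolding S(2) by (auto simp: affine_part_def proj_pt_in_proj_points)
  qed (rule p(2))
qed

text \<open>The homogenization \<open>q\<close> of \<open>b\<close> vanishes at every vector with a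
  zero coordinate, so the complement of its zero locus acquires no points off the torus. These sets
  serve as basic open sets.\<close>

lemma openin_laurent_nonzero:
  assumes "laurent b"
  shows "openin (subtopology zariski_topology V) (proj_pt ` {z \<in> affine_part V. b z \<noteq> 0})"
proof -
  obtain d p q N where "homogeneous d p" and q: "homogeneous d q"
    and "\<forall>x\<in>torus. poly_eval x p = b (\<lambda>v. x (Some v) / x None) * (\<Prod>v\<in>UNIV. x v) ^ N"
    and qN: "\<forall>x\<in>torus. poly_eval x q = b (\<lambda>v. x (Some v) / x None) * (\<Prod>v\<in>UNIV. x v) ^ N"
    and qt: "\<forall>x. poly_eval x q \<noteq> 0 \<longrightarrow> x \<in> torus"
    by (rule laurent_homogenization_pair[OF assms assms])
  have "proj_pt ` {z \<in> affine_part V. b z \<noteq> 0} = (proj_points - zero_locus {q}) \<inter> V"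
  proof (intro subset_antisym subsetI)
    fix P assume "P \<in> proj_pt ` {z \<in> affine_part V. b z \<noteq> 0}"
    then obtain z where z: "P = proj_pt z" "z \<in> torus" "P \<in> V" "b z \<noteq> 0"
      by (auto simp: affine_part_def)
    have "($) (hom_coords z) \<in> torus"
      using z(2) by (auto simp: nth_hom_coords split: option.split)
    then have "eval_at q (hom_coords z) \<noteq> 0"
      using z(2,4) by (simp add: eval_at_eq_poly_eval qN)
    then show "P \<in> (proj_points - zero_locus {q}) \<inter> V"
      using z hom_coords_in_proj_pt by (auto simp: zero_locus_def proj_pt_in_proj_points)
  next
    fix P assume P: "P \<in> (proj_points - zero_locus {q}) \<inter> V"
    then obtain x where x: "x \<in> P" "eval_at q x \<noteq> 0" by (auto simp: zero_locus_def)
    then have xt: "($) x \<in> torus" by (intro qt[rule_format]) (simp add: eval_at_eq_poly_eval)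
    define z where "z = (\<lambda>v. x $ Some v / x $ None)"
    have "z \<in> torus" using torus_divide[OF xt] by (simp add: z_def)
    moreover have "P = proj_pt z"
      unfolding z_def using P x xt by (intro proj_pt_eqI) auto
    moreover have "b z \<noteq> 0"
      using x(2) bspec[OF qN xt] by (auto simp: eval_at_eq_poly_eval z_def)
    ultimately show "P \<in> proj_pt ` {z \<in> affine_part V. b z \<noteq> 0}"
      using P by (auto simp: affine_part_def)
  qed
  then show ?thesis
    unfolding openin_subtopology openin_zariski using q by (metis singletonD)
qed

text \<open>Setting the last coordinate to 1 turns fractions of forms into fractions of Laurent
  polynomials. Conversely both parts are homogenized with the same power of the product of the
  coordinates, which cancels in the quotient.\<close>

lemma regular_proj_variety_iff:
  assumes W: "W \<subseteq> affine_part V"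
  shows "regular (proj_variety V) (proj_pt ` W) h \<longleftrightarrow> regular_on (affine_part V) W (\<lambda>y. h (proj_pt y))"
proof
  assume reg: "regular (proj_variety V) (proj_pt ` W) h"
  show "regular_on (affine_part V) W (\<lambda>y. h (proj_pt y))"
    unfolding regular_on_def
  proof
    fix y assume y: "y \<in> W"
    have "\<forall>P\<in>proj_pt ` W. \<exists>U d a b. openin (subtopology zariski_topology V) U \<and> P \<in> U \<and>
        U \<subseteq> proj_pt ` W \<and> homogeneous d a \<and> homogeneous d b \<and>
        (\<forall>Q\<in>U. \<forall>x\<in>Q. eval_at b x \<noteq> 0 \<and> h Q = eval_at a x / eval_at b x)"
      using reg by (simp only: proj_variety_def fun_space.simps)
    from bspec[OF this imageI[OF y]]
    obtain U d a b where U: "openin (subtopology zariski_topology V) U" "proj_pt y \<in> U"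
      "U \<subseteq> proj_pt ` W"
      "\<forall>Q\<in>U. \<forall>x\<in>Q. eval_at b x \<noteq> 0 \<and> h Q = eval_at a x / eval_at b x"
      by (elim exE conjE) (rule that)
    obtain \<phi> where \<phi>: "laurent \<phi>" "\<phi> y \<noteq> 0" "\<And>z. z \<in> affine_part V \<Longrightarrow> \<phi> z \<noteq> 0 \<Longrightarrow> proj_pt z \<in> U"
      using openin_laurent_neighbourhood[OF U(1,2)] by blast
    \<comment> \<open>The factor \<open>\<phi>\<close> does not change the quotient, but in the
      denominator it forces points with \<open>b' z \<noteq> 0\<close> into \<open>U\<close>, where
      the fraction represents \<open>h\<close>.\<close>
    define a' b' where "a' = (\<lambda>z. poly_eval (case_option 1 z) a * \<phi> z)"
      and "b' = (\<lambda>z. poly_eval (case_option 1 z) b * \<phi> z)"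
    have val: "poly_eval (case_option 1 z) b \<noteq> 0 \<and>
        h (proj_pt z) = poly_eval (case_option 1 z) a / poly_eval (case_option 1 z) b"
      if "proj_pt z \<in> U" for z
      using U(4) that hom_coords_in_proj_pt[of z] by (metis eval_at_eq_poly_eval nth_hom_coords)
    have "laurent a'" "laurent b'"
      unfolding a'_def b'_def by (intro laurent_mult laurent_poly_hom_coords \<phi>(1))+
    moreover have "b' y \<noteq> 0" using val[OF U(2)] \<phi>(2) by (simp add: b'_def)
    moreover have "z \<in> W \<and> h (proj_pt z) = a' z / b' z" if "z \<in> affine_part V" "b' z \<noteq> 0" for z
    proof -
      have "\<phi> z \<noteq> 0" using that(2) by (simp add: b'_def)
      with \<phi>(3) that(1) have zU: "proj_pt z \<in> U" by blast
      then have "z \<in> W" using U(3) by (auto simp: proj_pt_inj)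
      then show ?thesis using val[OF zU] \<open>\<phi> z \<noteq> 0\<close> by (simp add: a'_def b'_def)
    qed
    ultimately show "\<exists>a b. laurent a \<and> laurent b \<and> b y \<noteq> 0 \<and>
        (\<forall>z\<in>affine_part V. b z \<noteq> 0 \<longrightarrow> z \<in> W \<and> h (proj_pt z) = a z / b z)"
      by blast
  qed
next
  assume reg: "regular_on (affine_part V) W (\<lambda>y. h (proj_pt y))"
  have "\<exists>U d p q. openin (subtopology zariski_topology V) U \<and> proj_pt y \<in> U \<and> U \<subseteq> proj_pt ` W \<and>
      homogeneous d p \<and> homogeneous d q \<and>
      (\<forall>Q\<in>U. \<forall>x\<in>Q. eval_at q x \<noteq> 0 \<and> h Q = eval_at p x / eval_at q x)" if y: "y \<in> W" for y
  proof -
    obtain a b where ab: "laurent a" "laurent b" "b y \<noteq> 0"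
      "\<forall>z\<in>affine_part V. b z \<noteq> 0 \<longrightarrow> z \<in> W \<and> h (proj_pt z) = a z / b z"
      using reg y unfolding regular_on_def by blast
    obtain d p q N where pq: "homogeneous d p" "homogeneous d q"
      "\<forall>x\<in>torus. poly_eval x p = a (\<lambda>v. x (Some v) / x None) * (\<Prod>v\<in>UNIV. x v) ^ N"
      "\<forall>x\<in>torus. poly_eval x q = b (\<lambda>v. x (Some v) / x None) * (\<Prod>v\<in>UNIV. x v) ^ N"
      "\<forall>x. poly_eval x q \<noteq> 0 \<longrightarrow> x \<in> torus"
      by (rule laurent_homogenization_pair[OF ab(1,2)])
    let ?U = "proj_pt ` {z \<in> affine_part V. b z \<noteq> 0}"
    have "eval_at q x \<noteq> 0 \<and> h Q = eval_at p x / eval_at q x" if "Q \<in> ?U" "x \<in> Q" for Q x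
    proof -
      obtain z where z: "Q = proj_pt z" "z \<in> affine_part V" "b z \<noteq> 0" using \<open>Q \<in> ?U\<close> by blast
      have x: "($) x \<in> torus" "(\<lambda>v. x $ Some v / x $ None) = z"
        using proj_pt_coords[of x z] z that(2) by (auto simp: affine_part_def)
      then have "(\<Prod>v\<in>UNIV. x $ v) ^ N \<noteq> 0" by simp
      then show ?thesis
        using ab(4) z unfolding eval_at_eq_poly_eval bspec[OF pq(3) x(1)] bspec[OF pq(4) x(1)] x(2) by simp
    qed
    moreover have "proj_pt y \<in> ?U" "?U \<subseteq> proj_pt ` W" using ab W y by auto
    ultimately have "openin (subtopology zariski_topology V) ?U \<and> proj_pt y \<in> ?U \<and> ?U \<subseteq> proj_pt ` W \<and>
      homogeneous d p \<and> homogeneous d q \<and>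
      (\<forall>Q\<in>?U. \<forall>x\<in>Q. eval_at q x \<noteq> 0 \<and> h Q = eval_at p x / eval_at q x)"
      by (intro conjI ballI openin_laurent_nonzero[OF ab(2)] pq(1,2)) blast+
    then show ?thesis
      by (intro exI)
  qed
  then show "regular (proj_variety V) (proj_pt ` W) h"
    by (auto simp: proj_variety_def)
qed

lemma openin_proj_pt_iff:
  assumes W: "W \<subseteq> affine_part V"
  shows "openin (subtopology zariski_topology V) (proj_pt ` W) \<longleftrightarrow> regular_on (affine_part V) W (\<lambda>y. 0)"
proof
  assume op: "openin (subtopology zariski_topology V) (proj_pt ` W)"
  show "regular_on (affine_part V) W (\<lambda>y. 0)"
    unfolding regular_on_def
  proof
    fix y assume y: "y \<in> W"
    then obtain \<phi> where \<phi>: "laurent \<phi>" "\<phi> y \<noteq> 0"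
      "\<And>z. z \<in> affine_part V \<Longrightarrow> \<phi> z \<noteq> 0 \<Longrightarrow> proj_pt z \<in> proj_pt ` W"
      using openin_laurent_neighbourhood[OF op] by blast
    have "z \<in> W \<and> 0 = 0 / \<phi> z" if "z \<in> affine_part V" "\<phi> z \<noteq> 0" for z
      using \<phi>(3)[OF that] by (auto simp: proj_pt_inj)
    then show "\<exists>a b. laurent a \<and> laurent b \<and> b y \<noteq> 0 \<and>
        (\<forall>z\<in>affine_part V. b z \<noteq> 0 \<longrightarrow> z \<in> W \<and> 0 = a z / b z)"
      using \<phi>(1,2) laurent_const[of 0] by blast
  qed
next
  assume reg: "regular_on (affine_part V) W (\<lambda>y. 0)"
  show "openin (subtopology zariski_topology V) (proj_pt ` W)"
  proof (subst openin_subopen, clarify)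
    fix y assume y: "y \<in> W"
    then obtain b where b: "laurent b" "b y \<noteq> 0" "\<forall>z\<in>affine_part V. b z \<noteq> 0 \<longrightarrow> z \<in> W"
      using reg unfolding regular_on_def by blast
    then show "\<exists>T. openin (subtopology zariski_topology V) T \<and> proj_pt y \<in> T \<and> T \<subseteq> proj_pt ` W"
      using openin_laurent_nonzero[OF b(1), of V] W y by blast
  qed
qed

section \<open>Birational maps and the diagonal group\<close>

text \<open>An injection matching open sets and sections is a morphism in both directions. The
  assumption \<open>cong\<close> is there because going to the image and back changes a section
  outside \<open>W\<close>, and an arbitrary \<open>fun_space\<close> may be sensitive to
  that.\<close>

lemma birationalI:
  fixes Y :: "'p fun_space" and Z :: "'q fun_space"
  assumes U: "openin (space_top Y) U" "U \<noteq> {}" and inj: "inj_on f U"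
    and op: "\<And>W. W \<subseteq> U \<Longrightarrow> openin (space_top Z) (f ` W) \<longleftrightarrow> openin (space_top Y) W"
    and reg: "\<And>W h. W \<subseteq> U \<Longrightarrow> regular Z (f ` W) h \<longleftrightarrow> regular Y W (\<lambda>P. h (f P))"
    and cong: "\<And>W h h'. W \<subseteq> U \<Longrightarrow> regular Y W h \<Longrightarrow> (\<And>P. P \<in> W \<Longrightarrow> h P = h' P) \<Longrightarrow> regular Y W h'"
  shows "birational Y Z"
proof -
  let ?V = "f ` U" and ?g = "inv_into U f"
  let ?YU = "open_subspace Y U" and ?ZV = "open_subspace Z ?V"
  have V: "openin (space_top Z) ?V" using op[of U] U(1) by simp
  have pts: "points ?YU = U" "points ?ZV = ?V"
    using openin_subset[OF U(1)] openin_subset[OF V] by (auto simp: open_subspace_def)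
  have opens: "openin (space_top ?YU) W \<longleftrightarrow> openin (space_top Y) W \<and> W \<subseteq> U"
    "openin (space_top ?ZV) W' \<longleftrightarrow> openin (space_top Z) W' \<and> W' \<subseteq> ?V" for W W'
    by (simp_all add: open_subspace_def openin_open_subtopology U(1) V)
  have regs: "regular ?YU = regular Y" "regular ?ZV = regular Z"
    by (simp_all add: open_subspace_def)
  have image: "f ` {P \<in> U. f P \<in> W} = W" if "W \<subseteq> ?V" for W
    using that by blast
  have preimage: "{Q \<in> ?V. ?g Q \<in> W} = f ` W" if "W \<subseteq> U" for W
    using that inj by (auto simp: inv_into_f_f)
  have "morphism ?YU ?ZV f"
    unfolding morphism_def continuous_map_def pts opens regs
  proof (intro conjI allI impI)
    fix W assume W: "openin (space_top Z) W \<and> W \<subseteq> ?V"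
    then show "openin (space_top Y) {P \<in> U. f P \<in> W}"
      using op[of "{P \<in> U. f P \<in> W}"] image[of W] by auto
  next
    fix W h assume W: "(openin (space_top Z) W \<and> W \<subseteq> ?V) \<and> regular Z W h"
    then show "regular Y {P \<in> U. f P \<in> W} (h \<circ> f)"
      using reg[of "{P \<in> U. f P \<in> W}" h] image[of W] by (auto simp: comp_def)
  qed auto
  moreover have "morphism ?ZV ?YU ?g"
    unfolding morphism_def continuous_map_def pts opens regs
  proof (intro conjI allI impI)
    fix W assume W: "openin (space_top Y) W \<and> W \<subseteq> U"
    then show "openin (space_top Z) {Q \<in> ?V. ?g Q \<in> W}"
      using op[of W] preimage[of W] by simp
  next
    fix W h assume W: "(openin (space_top Y) W \<and> W \<subseteq> U) \<and> regular Y W h"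
    have "regular Y W (\<lambda>P. (h \<circ> ?g) (f P))"
    proof (rule cong)
      show "W \<subseteq> U" "regular Y W h" using W by blast+
      show "h P = (h \<circ> ?g) (f P)" if "P \<in> W" for P
        using W that inv_into_f_f[OF inj, of P] by auto
    qed
    then show "regular Z {Q \<in> ?V. ?g Q \<in> W} (h \<circ> ?g)"
      using W reg[of W "h \<circ> ?g"] preimage[of W] by simp
  qed (auto simp: inv_into_into)
  ultimately have "isomorphic ?YU ?ZV"
    unfolding isomorphic_def pts using inj
    by (intro exI[of _ f] exI[of _ ?g]) (simp add: inv_into_f_f f_inv_into_f)
  then show ?thesis
    unfolding birational_def using U V by blast
qed

lemma openin_quotient_space:
  "openin (space_top (quotient_space Y G \<phi>)) U \<longleftrightarrow>
     U \<subseteq> orbits G (points Y) \<phi> \<and> openin (space_top Y) {P \<in> points Y. orbit G \<phi> P \<in> U}"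
  by (simp add: quotient_space_def topology_inverse' istopology_quotient)

lemma points_proj_variety: "V \<subseteq> proj_points \<Longrightarrow> points (proj_variety V) = V"
proof -
  assume V: "V \<subseteq> proj_points"
  have "openin zariski_topology proj_points"
    unfolding openin_zariski
    by (intro exI[of _ "{1}"])
      (use homogeneous_one in \<open>auto simp: zero_locus_def eval_at_eq_poly_eval proj_points_def
        intro: exI[of _ "1 :: complex"]\<close>)
  then have "proj_points \<subseteq> topspace (zariski_topology :: (complex^'a) set topology)"
    by (rule openin_subset)
  with V show ?thesis by (auto simp: proj_variety_def)
qed

context torus_quotient
begin

text \<open>A point \<open>y\<close> goes to the orbit of a preimage under \<open>u\<close>. That
  orbit is the whole fibre over \<open>y\<close>, so the choice in \<open>r\<close> is immaterial
  and the map is injective. Sections of the quotient are by definition sections pulled back to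
  \<open>X\<close>, which \<open>regular_on_iff\<close> compares with those on
  \<open>Y\<close>.\<close>

lemma birational_quotient:
  fixes G :: "('g, 'm) monoid_scheme"
  assumes V: "X \<subseteq> proj_points" "Y \<subseteq> proj_points"
    and orbit: "\<And>x. x \<in> torus \<Longrightarrow> orbit G \<phi> (proj_pt x) = proj_pt ` {z \<in> torus. u z = u x}"
    and refl: "\<And>P. P \<in> X \<Longrightarrow> P \<in> orbit G \<phi> P"
    and XY: "\<And>x. x \<in> torus \<Longrightarrow> proj_pt x \<in> X \<longleftrightarrow> proj_pt (u x) \<in> Y"
    and ne: "affine_part X \<noteq> {}"
  shows "birational (proj_variety Y) (quotient_space (proj_variety X) G \<phi>)"
proof -
  let ?Y = "proj_variety Y" and ?Z = "quotient_space (proj_variety X) G \<phi>"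
  define A B where "A = affine_part X" and "B = affine_part Y"
  have A: "A \<subseteq> torus" and B: "B \<subseteq> torus" by (auto simp: A_def B_def affine_part_def)
  have AB: "x \<in> A \<longleftrightarrow> u x \<in> B" if "x \<in> torus" for x
    using that XY[OF that] u_torus[OF that] by (simp add: A_def B_def affine_part_def)
  define r where "r = (\<lambda>y. SOME x. x \<in> torus \<and> u x = y)"
  have r: "r y \<in> torus" "u (r y) = y" if y: "y \<in> torus" for y
  proof -
    obtain x where "x \<in> torus \<and> u x = y" using u_surj[OF y] by blast
    then have "r y \<in> torus \<and> u (r y) = y" unfolding r_def by (rule someI[where P = "\<lambda>x. x \<in> torus \<and> u x = y"])
    then show "r y \<in> torus" "u (r y) = y" by blast+
  qed
  define f where "f = (\<lambda>P. orbit G \<phi> (proj_pt (r (inv_into UNIV proj_pt P))))"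
  have "inv_into UNIV proj_pt (proj_pt y) = y" for y :: "'n \<Rightarrow> complex"
    by (simp add: inv_into_f_f inj_def proj_pt_inj)
  then have f: "f (proj_pt y) = proj_pt ` {z \<in> torus. u z = y}" if "y \<in> torus" for y
    using r[OF that] by (simp add: f_def orbit)
  have f_u: "f (proj_pt (u x)) = orbit G \<phi> (proj_pt x)" if "x \<in> torus" for x
    unfolding f[OF u_torus[OF that]] orbit[OF that] ..
  have f_eq: "f (proj_pt y) = f (proj_pt y') \<longleftrightarrow> y = y'" if y: "y \<in> torus" "y' \<in> torus" for y y'
  proof
    assume "f (proj_pt y) = f (proj_pt y')"
    moreover have "proj_pt (r y) \<in> f (proj_pt y)" unfolding f[OF y(1)] using r[OF y(1)] by blast
    ultimately show "y = y'" unfolding f[OF y(2)] using r[OF y(1)] by (auto simp: proj_pt_inj)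
  qed simp
  \<comment> \<open>By reflexivity \<open>P\<close> belongs to its own orbit, here a fibre of
    \<open>u\<close> in the torus. Hence a point off the torus never has its orbit in the image of
    \<open>f\<close>.\<close>
  have pre: "{P \<in> X. orbit G \<phi> P \<in> f ` proj_pt ` W} = proj_pt ` {x \<in> A. u x \<in> W}" if W: "W \<subseteq> B" for W
  proof (intro subset_antisym subsetI)
    fix P assume "P \<in> {P \<in> X. orbit G \<phi> P \<in> f ` proj_pt ` W}"
    then obtain y where y: "P \<in> X" "y \<in> W" "orbit G \<phi> P = f (proj_pt y)" by blast
    then have "y \<in> torus" using W B by blast
    then obtain x where "P = proj_pt x" "x \<in> torus" "u x = y"
      using refl[OF y(1)] unfolding y(3) by (auto simp: f)
    then show "P \<in> proj_pt ` {x \<in> A. u x \<in> W}"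
      using y by (auto simp: A_def affine_part_def)
  next
    fix P assume "P \<in> proj_pt ` {x \<in> A. u x \<in> W}"
    then obtain x where x: "P = proj_pt x" "x \<in> torus" "P \<in> X" "u x \<in> W"
      by (auto simp: A_def affine_part_def)
    then show "P \<in> {P \<in> X. orbit G \<phi> P \<in> f ` proj_pt ` W}"
      using f_u[OF x(2)] by (auto intro!: image_eqI[of _ f])
  qed
  note reg_iff = regular_on_iff[OF A B AB]
  have sub: "{x \<in> A. u x \<in> W} \<subseteq> affine_part X" for W by (auto simp: A_def)
  have op: "openin (space_top ?Z) (f ` proj_pt ` W) \<longleftrightarrow> openin (space_top ?Y) (proj_pt ` W)"
    if W: "W \<subseteq> B" for W
  proof -
    have "f ` proj_pt ` W \<subseteq> orbits G X \<phi>"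
    proof clarify
      fix y assume y: "y \<in> W"
      then have "y \<in> torus" "y \<in> B" using W B by auto
      then have "r y \<in> A" "f (proj_pt y) = orbit G \<phi> (proj_pt (r y))"
        using r[of y] AB[of "r y"] f_u[of "r y"] by auto
      then show "f (proj_pt y) \<in> orbits G X \<phi>" by (auto simp: orbits_def A_def affine_part_def)
    qed
    then have "openin (space_top ?Z) (f ` proj_pt ` W) \<longleftrightarrow>
        openin (subtopology zariski_topology X) (proj_pt ` {x \<in> A. u x \<in> W})"
      unfolding openin_quotient_space points_proj_variety[OF V(1)] pre[OF W] by (simp add: proj_variety_def)
    \<comment> \<open>Openness is regularity of the zero function, so the transfer of regular
      functions also transfers the topology.\<close>
    also have "\<dots> \<longleftrightarrow> regular_on B W (\<lambda>y. 0)"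
      unfolding openin_proj_pt_iff[OF sub] using reg_iff[OF _ W, of "\<lambda>y. 0"] by (simp add: A_def)
    also have "\<dots> \<longleftrightarrow> openin (space_top ?Y) (proj_pt ` W)"
      using openin_proj_pt_iff[of W Y] W by (simp add: proj_variety_def B_def)
    finally show ?thesis .
  qed
  have reg: "regular ?Z (f ` proj_pt ` W) h \<longleftrightarrow> regular ?Y (proj_pt ` W) (\<lambda>P. h (f P))"
    if W: "W \<subseteq> B" for W h
  proof -
    have "regular ?Z (f ` proj_pt ` W) h \<longleftrightarrow>
        regular (proj_variety X) (proj_pt ` {x \<in> A. u x \<in> W}) (\<lambda>P. h (orbit G \<phi> P))"
      unfolding quotient_space_def by (simp add: points_proj_variety[OF V(1)] pre[OF W])
    also have "\<dots> \<longleftrightarrow> regular_on A {x \<in> A. u x \<in> W} (\<lambda>x. h (orbit G \<phi> (proj_pt x)))"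
      using regular_proj_variety_iff[OF sub] by (simp add: A_def)
    also have "\<dots> \<longleftrightarrow> regular_on A {x \<in> A. u x \<in> W} (\<lambda>x. h (f (proj_pt (u x))))"
      using A by (intro iffI; elim regular_on_cong) (auto simp: f_u subset_iff)
    also have "\<dots> \<longleftrightarrow> regular_on B W (\<lambda>y. h (f (proj_pt y)))"
      by (rule reg_iff[OF _ W])
    also have "\<dots> \<longleftrightarrow> regular ?Y (proj_pt ` W) (\<lambda>P. h (f P))"
      using regular_proj_variety_iff[of W Y] W by (simp add: B_def)
    finally show ?thesis .
  qed
  show ?thesis
  proof (rule birationalI)
    have "regular_on B B (\<lambda>y. 0)"
      unfolding regular_on_def
      by (intro ballI exI[of _ "\<lambda>z. 0"] exI[of _ "\<lambda>z. 1"]) (simp add: laurent_const)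
    then show "openin (space_top ?Y) (proj_pt ` B)"
      using openin_proj_pt_iff[of B Y] by (simp add: proj_variety_def B_def)
    show "proj_pt ` B \<noteq> {}"
      using ne A AB by (auto simp: A_def[symmetric])
    show "inj_on f (proj_pt ` B)"
      using B f_eq by (auto simp: inj_on_def subset_iff)
    show "openin (space_top ?Z) (f ` W) \<longleftrightarrow> openin (space_top ?Y) W" if "W \<subseteq> proj_pt ` B" for W
      using that by (elim subset_imageE) (simp only: op)
    show "regular ?Z (f ` W) h \<longleftrightarrow> regular ?Y W (\<lambda>P. h (f P))" if "W \<subseteq> proj_pt ` B" for W h
      using that by (elim subset_imageE) (simp only: reg)
    show "regular ?Y W h'" if W: "W \<subseteq> proj_pt ` B" "regular ?Y W h" "\<And>P. P \<in> W \<Longrightarrow> h P = h' P" for W h h'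
    proof -
      obtain W' where W': "W' \<subseteq> affine_part Y" "W = proj_pt ` W'"
        using W(1) unfolding B_def subset_image_iff by blast
      show ?thesis
        using W(2,3) unfolding W'(2) regular_proj_variety_iff[OF W'(1)] by (elim regular_on_cong) auto
    qed
  qed
qed

end

section \<open>Diagonal matrices and the groups they generate\<close>

lemma diag_mult: "diag s ** diag t = diag (\<lambda>v. s v * t v)"
  by (simp add: diag_def matrix_matrix_mult_def vec_eq_iff if_distrib[of "\<lambda>x. x * _"]
      if_distrib[of "\<lambda>x. _ * x"] cong: if_cong)

lemma diag_one: "diag (\<lambda>v. 1) = mat 1"
  by (simp add: diag_def mat_def vec_eq_iff)

lemma diag_carrier: "(\<And>v. t v \<noteq> 0) \<Longrightarrow> diag t \<in> carrier GL"
  unfolding GL_def invertible_def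
  by (auto intro!: exI[of _ "diag (\<lambda>v. inverse (t v))"] simp: diag_mult diag_one)

lemma inv_diag:
  assumes "\<And>v. t v \<noteq> 0"
  shows "inv\<^bsub>GL\<^esub> diag t = diag (\<lambda>v. inverse (t v))"
proof -
  interpret group GL by (rule group_GL)
  show ?thesis
    using assms by (intro inv_equality diag_carrier) (simp_all add: GL_def diag_mult diag_one)
qed

definition affine_diag :: "('n \<Rightarrow> complex) \<Rightarrow> complex^'n::finite option^'n option" where
  "affine_diag s = diag (case_option 1 s)"

lemma affine_diag_mult: "affine_diag s ** affine_diag t = affine_diag (\<lambda>v. s v * t v)"
  unfolding affine_diag_def diag_mult by (rule arg_cong[of _ _ diag]) (auto split: option.split)

lemma affine_diag_one: "affine_diag (\<lambda>v. 1) = mat 1"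
  unfolding affine_diag_def diag_one[symmetric] by (rule arg_cong[of _ _ diag]) (auto split: option.split)

lemma affine_diag_carrier: "s \<in> torus \<Longrightarrow> affine_diag s \<in> carrier GL"
  unfolding affine_diag_def by (intro diag_carrier) (auto split: option.split)

lemma inv_affine_diag:
  assumes "s \<in> torus"
  shows "inv\<^bsub>GL\<^esub> affine_diag s = affine_diag (\<lambda>v. inverse (s v))"
proof -
  have "inv\<^bsub>GL\<^esub> affine_diag s = diag (\<lambda>v. inverse (case_option 1 s v))"
    unfolding affine_diag_def using assms by (intro inv_diag) (auto split: option.split)
  also have "\<dots> = affine_diag (\<lambda>v. inverse (s v))"
    unfolding affine_diag_def by (rule arg_cong[of _ _ diag]) (auto split: option.split)
  finally show ?thesis .
qed

lemma affine_diag_nth: "affine_diag s $ Some j $ Some j = s j"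
  by (simp add: affine_diag_def diag_def)

lemma affine_diag_hom_coords: "affine_diag s *v hom_coords x = hom_coords (\<lambda>v. s v * x v)"
proof -
  have "(\<Sum>j\<in>UNIV. (if i = j then case_option 1 s i else 0) * hom_coords x $ j) =
      case_option 1 s i * hom_coords x $ i" for i
    by (simp add: if_distrib[of "\<lambda>a. a * _"] cong: if_cong)
  then show ?thesis
    by (auto simp: affine_diag_def diag_def matrix_vector_mult_def vec_eq_iff hom_coords_def split: option.split)
qed

lemma mat_mult_vec: "mat c *v x = c *s (x :: complex^'v::finite)"
  by (simp add: mat_def matrix_vector_mult_def vec_eq_iff if_distrib[of "\<lambda>a. a * _"] cong: if_cong)

lemma scalars_coset: "scalars #>\<^bsub>GL\<^esub> A = {mat c ** A |c. c \<noteq> 0}"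
  by (auto simp: r_coset_def scalars_def GL_def)

text \<open>The last diagonal entry 1 preserves the normalization of \<open>hom_coords\<close>, and
  the scalar in the class only moves a vector along its line.\<close>

lemma proj_action_proj_pt:
  "proj_action (scalars #>\<^bsub>GL\<^esub> affine_diag s) (proj_pt x) = proj_pt (\<lambda>v. s v * x v)"
proof -
  have *: "(mat c ** affine_diag s) *v (c' *s hom_coords x) = (c * c') *s hom_coords (\<lambda>v. s v * x v)" for c c'
    by (simp add: mat_mult_vec vector_smult_assoc vector_scalar_commute
        affine_diag_hom_coords flip: matrix_vector_mul_assoc)
  show ?thesis
  proof (intro subset_antisym subsetI)
    fix y assume "y \<in> proj_action (scalars #>\<^bsub>GL\<^esub> affine_diag s) (proj_pt x)"
    then obtain c c' where "y = (mat c ** affine_diag s) *v (c' *s hom_coords x)" "c \<noteq> 0" "c' \<noteq> 0"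
      unfolding proj_action_def scalars_coset proj_pt_def by blast
    then show "y \<in> proj_pt (\<lambda>v. s v * x v)"
      unfolding * proj_pt_def by (auto intro!: exI[of _ "c * c'"])
  next
    fix y assume "y \<in> proj_pt (\<lambda>v. s v * x v)"
    then obtain c where "c \<noteq> 0" "y = (mat c ** affine_diag s) *v (1 *s hom_coords x)"
      unfolding * proj_pt_def by auto
    then show "y \<in> proj_action (scalars #>\<^bsub>GL\<^esub> affine_diag s) (proj_pt x)"
      unfolding proj_action_def scalars_coset proj_pt_def mem_Collect_eq using one_neq_zero by blast
  qed
qed

lemma proj_action_one:
  assumes "P \<in> proj_points"
  shows "proj_action (scalars #>\<^bsub>GL\<^esub> mat 1) P = P"
proof -
  obtain z where z: "P = {c *s z |c. c \<noteq> 0}" using assms by (auto simp: proj_points_def)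
  have "proj_action (scalars #>\<^bsub>GL\<^esub> mat 1) P = {mat c *v (c' *s z) |c c'. c \<noteq> 0 \<and> c' \<noteq> 0}"
    unfolding proj_action_def scalars_coset z matrix_mul_rid by blast
  also have "\<dots> = {(c * c') *s z |c c'. c \<noteq> 0 \<and> c' \<noteq> 0}"
    unfolding mat_mult_vec vector_smult_assoc ..
  also have "\<dots> = P"
    unfolding z by (auto intro: exI[of _ "1::complex"]) (metis mult.left_neutral one_neq_zero)
  finally show ?thesis .
qed

text \<open>The coset map is a homomorphism from \<open>GL\<close> to \<open>PGL\<close>, and images
  of generated subgroups are generated by the images. Orbits can thus be computed with matrices
  instead of classes.\<close>

lemma carrier_diag_group:
  fixes lam :: "nat \<Rightarrow> 'n::finite \<Rightarrow> complex"
  assumes "\<And>i. i < k \<Longrightarrow> lam i \<in> torus"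
  shows "carrier (diag_group k lam) = (\<lambda>A. scalars #>\<^bsub>GL\<^esub> A) ` lifted_group k lam"
proof -
  interpret group_hom "GL :: (complex^'n option^'n option) monoid" PGL "\<lambda>A. scalars #>\<^bsub>GL\<^esub> A"
    unfolding PGL_def group_hom_def group_hom_axioms_def
    by (intro conjI group_GL normal.factorgroup_is_group[OF scalars_normal]
        normal.r_coset_hom_Mod[OF scalars_normal])
  have "gen_matrix lam ` {..<k} \<subseteq> carrier GL"
    using affine_diag_carrier[OF assms] by (auto simp: gen_matrix_def affine_diag_def)
  from generate_img[OF this] show ?thesis
    by (simp add: diag_group_def lifted_group_def image_image)
qed

text \<open>A preimage under \<open>affine_diag\<close>; that it accounts for every matrix of the
  generated group is \<open>lifted_group_eq\<close>.\<close>

definition torus_group :: "nat \<Rightarrow> (nat \<Rightarrow> 'n::finite \<Rightarrow> complex) \<Rightarrow> ('n \<Rightarrow> complex) set" where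
  "torus_group k lam = {s. affine_diag s \<in> lifted_group k lam}"

context
  fixes k :: nat and lam :: "nat \<Rightarrow> 'n::finite \<Rightarrow> complex"
  assumes root_of_unity: "\<And>i j. i < k \<Longrightarrow> \<exists>m>0. lam i j ^ m = 1"
begin

lemma lam_torus: "i < k \<Longrightarrow> lam i \<in> torus"
  using root_of_unity[of i] by (auto simp: power_0_left) (metis not_gr0 zero_neq_one zero_power)

text \<open>The product of one exponent per entry is a multiple of each of them. A common exponent
  survives products and inverses, so the generated group has only \<open>N\<close>-th roots of unity
  as entries and is finite.\<close>

lemma common_exponent:
  obtains N where "N > 0" "\<And>i j. i < k \<Longrightarrow> lam i j ^ N = 1"
proof -
  obtain m where m: "\<And>i j. i < k \<Longrightarrow> m i j > 0 \<and> lam i j ^ m i j = 1"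
    using root_of_unity by metis
  define N where "N = (\<Prod>i<k. \<Prod>j\<in>UNIV. m i j)"
  have "m i j dvd N" if "i < k" for i j
    unfolding N_def using that
    by (meson UNIV_I dvd_prod_eqI dvd_trans finite_class.finite_UNIV finite_lessThan lessThan_iff dvd_prodI)
  then have "lam i j ^ N = 1" if "i < k" for i j
    using m[OF that] that by (metis dvd_def power_mult power_one)
  moreover have "N > 0" unfolding N_def using m by (auto intro!: prod_pos)
  ultimately show thesis using that by blast
qed

lemma lifted_group_elim:
  assumes A: "A \<in> lifted_group k lam" and N: "N > 0" "\<And>i j. i < k \<Longrightarrow> lam i j ^ N = 1"
  shows "\<exists>s. A = affine_diag s \<and> (\<forall>v. s v ^ N = 1)"
  using A unfolding lifted_group_def
proof (induction rule: generate.induct)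
  case one
  then show ?case
    by (intro exI[of _ "\<lambda>v. 1"]) (simp add: affine_diag_one GL_def)
next
  case (incl A)
  then show ?case using N(2) by (auto simp: gen_matrix_def affine_diag_def)
next
  case (inv A)
  then obtain i where i: "i < k" "A = affine_diag (lam i)" by (auto simp: gen_matrix_def affine_diag_def)
  then show ?case
    using N(2) by (intro exI[of _ "\<lambda>v. inverse (lam i v)"]) (simp add: inv_affine_diag[OF lam_torus[OF i(1)]] power_inverse)
next
  case (eng A A')
  then obtain s t where "A = affine_diag s" "\<forall>v. s v ^ N = 1" "A' = affine_diag t" "\<forall>v. t v ^ N = 1"
    by blast
  then show ?case
    by (intro exI[of _ "\<lambda>v. s v * t v"]) (simp add: GL_def affine_diag_mult power_mult_distrib)
qed

lemma lifted_group_eq: "lifted_group k lam = affine_diag ` torus_group k lam"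
proof -
  obtain N where N: "N > 0" "\<And>i j. i < k \<Longrightarrow> lam i j ^ N = 1" using common_exponent by blast
  show ?thesis using lifted_group_elim[OF _ N] unfolding torus_group_def by blast
qed

lemma carrier_diag_group_eq:
  "carrier (diag_group k lam) = (\<lambda>s. scalars #>\<^bsub>GL\<^esub> affine_diag s) ` torus_group k lam"
  using carrier_diag_group[of k lam] lam_torus by (simp add: lifted_group_eq image_image)

lemma affine_diag_inj: "affine_diag s = affine_diag t \<Longrightarrow> s = t"
  by (rule ext) (metis affine_diag_nth)

lemma finite_torus_subgroup_torus_group: "finite_torus_subgroup (torus_group k lam)"
proof -
  obtain N where N: "N > 0" "\<And>i j. i < k \<Longrightarrow> lam i j ^ N = 1" using common_exponent by blast
  have pow: "s v ^ N = 1" if "s \<in> torus_group k lam" for s v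
    using lifted_group_elim[OF _ N] that affine_diag_inj unfolding torus_group_def mem_Collect_eq by metis
  interpret group "GL :: (complex^'n option^'n option) monoid" by (rule group_GL)
  have sub: "subgroup (lifted_group k lam) GL"
    unfolding lifted_group_def using affine_diag_carrier[OF lam_torus]
    by (intro generate_is_subgroup) (auto simp: gen_matrix_def affine_diag_def)
  have tor: "torus_group k lam \<subseteq> torus"
  proof clarify
    fix s v assume "s \<in> torus_group k lam" "s v = 0"
    then show False using pow[of s v] N(1) by (simp add: power_0_left)
  qed
  show ?thesis
  proof
    have "torus_group k lam \<subseteq> (UNIV \<rightarrow>\<^sub>E {z. z ^ N = 1})" using pow by auto
    moreover have "finite (UNIV \<rightarrow>\<^sub>E {z :: complex. z ^ N = 1} :: ('n \<Rightarrow> complex) set)"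
      using finite_roots_unity[of N] N(1) by (intro finite_PiE) auto
    ultimately show "finite (torus_group k lam)" by (rule finite_subset)
    show "torus_group k lam \<subseteq> torus" by (rule tor)
    show "(\<lambda>v. 1) \<in> torus_group k lam"
      using subgroup.one_closed[OF sub] by (simp add: torus_group_def affine_diag_one GL_def)
    show "(\<lambda>v. s v * t v) \<in> torus_group k lam" if "s \<in> torus_group k lam" "t \<in> torus_group k lam" for s t
      using subgroup.m_closed[OF sub] that by (simp add: torus_group_def GL_def flip: affine_diag_mult)
    show "(\<lambda>v. inverse (s v)) \<in> torus_group k lam" if "s \<in> torus_group k lam" for s
      using subgroup.m_inv_closed[OF sub, of "affine_diag s"] that inv_affine_diag[OF subsetD[OF tor that]]
      by (simp add: torus_group_def)
  qed
qed

lemma orbit_proj_pt: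
  "orbit (diag_group k lam) proj_action (proj_pt x) = (\<lambda>s. proj_pt (\<lambda>v. s v * x v)) ` torus_group k lam"
  unfolding orbit_def carrier_diag_group_eq proj_action_proj_pt[symmetric] by blast

text \<open>Covers all projective points, since the quotient also contains orbits off the torus,
  which \<open>birational_quotient\<close> has to keep out of the image.\<close>

lemma orbit_refl:
  assumes "P \<in> proj_points"
  shows "P \<in> orbit (diag_group k lam) proj_action P"
proof -
  interpret finite_torus_subgroup "torus_group k lam" by (rule finite_torus_subgroup_torus_group)
  have "P = proj_action (scalars #>\<^bsub>GL\<^esub> affine_diag (\<lambda>v. 1)) P"
    by (simp add: affine_diag_one proj_action_one[OF assms])
  then show ?thesis
    unfolding orbit_def carrier_diag_group_eq using one_H by blast
qed

end

section \<open>From the invariant field to the kernel, and conclusion\<close>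

text \<open>
  For \<open>t\<close> outside \<open>H\<close>, averaging a polynomial that is 1 at the unit element and vanishes at the other
  points of \<open>H\<close> and of \<open>t H\<close> gives an invariant that distinguishes \<open>t\<close> from the unit element.
\<close>

lemma torus_quotientI:
  fixes H :: "('n::{finite,linorder} \<Rightarrow> complex) set"
  assumes H: "finite_torus_subgroup H"
    and field: "{r. \<forall>s\<in>H. scale_ratfun s r = r} = adjoin (range (\<lambda>i. rational_monomial (\<alpha> i)))"
  shows "torus_quotient H \<alpha>"
proof -
  interpret finite_torus_subgroup H by (rule H)
  have monomial_fixed: "scale_ratfun t (rational_monomial m) = rational_monomial m \<longleftrightarrow> monomial m t = 1"
    if t: "t \<in> torus" for t and m :: "'n \<Rightarrow> int"
  proof
    \<comment> \<open>Every monomial has value 1 at the unit point, so evaluating there reads off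
      the factor by which \<open>t\<close> scales it.\<close>
    have rm: "ratfun_eval (\<lambda>v. 1) (rational_monomial m) 1"
      using ratfun_eval_rational_monomial[of "\<lambda>v. 1" m] by (simp add: monomial_one)
    assume "scale_ratfun t (rational_monomial m) = rational_monomial m"
    then have "ratfun_const (monomial m t) * rational_monomial m = rational_monomial m"
      using t by (simp add: scale_ratfun_rational_monomial)
    then have "ratfun_eval (\<lambda>v. 1) (rational_monomial m) (monomial m t * 1)"
      using ratfun_eval_mult[OF ratfun_eval_const rm, of "monomial m t"] by (simp only:)
    then show "monomial m t = 1" using ratfun_eval_unique[OF _ rm] by simp
  next
    assume "monomial m t = 1"
    then show "scale_ratfun t (rational_monomial m) = rational_monomial m"
      using t by (simp add: scale_ratfun_rational_monomial ratfun_const_hom)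
  qed
  have "t \<in> H \<longleftrightarrow> (\<forall>i. monomial (\<alpha> i) t = 1)" if t: "t \<in> torus" for t
  proof (intro iffI allI)
    fix i assume "t \<in> H"
    moreover have "rational_monomial (\<alpha> i) \<in> {r. \<forall>s\<in>H. scale_ratfun s r = r}"
      unfolding field by (rule adjoin.gen) simp
    ultimately show "monomial (\<alpha> i) t = 1" unfolding monomial_fixed[OF t, symmetric] by blast
  next
    assume fixed: "\<forall>i. monomial (\<alpha> i) t = 1"
    show "t \<in> H"
    proof (rule ccontr)
      assume tH: "t \<notin> H"
      let ?B = "(H - {\<lambda>v. 1}) \<union> (\<lambda>s v. s v * t v) ` H"
      have "(\<lambda>v. 1) \<notin> ?B"
      proof
        assume "(\<lambda>v. 1) \<in> ?B"
        then obtain s where s: "s \<in> H" "(\<lambda>v. 1) = (\<lambda>v. s v * t v)" by blast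
        have "t v = inverse (s v)" for v
          using fun_cong[OF s(2), of v] by (metis inverse_unique)
        then have "t = (\<lambda>v. inverse (s v))" by blast
        then show False using inverse_H[OF s(1)] tH by simp
      qed
      then obtain g where g: "poly_eval (\<lambda>v. 1) g = 1" "\<And>b. b \<in> ?B \<Longrightarrow> poly_eval b g = 0"
        using exists_separating_polynomial[of ?B "\<lambda>v. 1"] finite_H by auto
      define a where "a = (\<Sum>s\<in>H. scale_vars s g)"
      have "scale_vars s a = a" if s: "s \<in> H" for s
      proof -
        have "scale_vars s a = (\<Sum>s'\<in>H. scale_vars (\<lambda>v. s v * s' v) g)"
          by (simp add: a_def scale_vars_sum scale_vars_scale_vars)
        also have "\<dots> = a"
          unfolding a_def by (rule sum.reindex_bij_betw[OF bij_betw_H[OF s]])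
        finally show ?thesis .
      qed
      then have "of_mpoly a \<in> {r. \<forall>s\<in>H. scale_ratfun s r = r}"
        using H_torus by (auto simp: scale_ratfun_of_mpoly subset_iff)
      then have "scale_ratfun t (of_mpoly a) = of_mpoly a"
        unfolding field using t monomial_fixed[OF t] fixed
        by (elim scale_ratfun_adjoin_fixed[rotated]) auto
      then have "of_mpoly (scale_vars t a) = of_mpoly a"
        using t by (simp add: scale_ratfun_of_mpoly)
      then have "poly_eval (\<lambda>v. 1) (scale_vars t a) = poly_eval (\<lambda>v. 1) a"
        using ratfun_eval_of_mpoly ratfun_eval_unique by metis
      \<comment> \<open>At the unit point the scaled sum collects the values of \<open>g\<close> on
        the translate of \<open>H\<close> by \<open>t\<close>, all 0, while \<open>a\<close>
        collects those on \<open>H\<close>, where only the unit element contributes.\<close>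
      moreover have "poly_eval (\<lambda>v. 1) (scale_vars t a) = 0"
        using g(2) by (simp add: a_def poly_eval_scale_vars)
      moreover have "poly_eval (\<lambda>v. 1) a = (\<Sum>s\<in>H. if s = (\<lambda>v. 1) then 1 else 0)"
        using g by (simp add: a_def poly_eval_scale_vars) (intro sum.cong, auto)
      ultimately show False using finite_H one_H by simp
    qed
  qed
  then show ?thesis by unfold_locales
qed

lemma proj_pt_in_hypersurface_iff:
  assumes "homogeneous d F"
  shows "proj_pt x \<in> hypersurface F \<longleftrightarrow> poly_eval (case_option 1 x) F = 0"
  using eval_at_proj_pt[OF assms, of _ x] hom_coords_in_proj_pt[of x]
  by (auto simp: hypersurface_def zero_locus_def proj_pt_in_proj_points)

text \<open>At any vector \<open>x\<close> of the point the substituted ratios take the values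
  \<open>y\<close>, so the equation reads: \<open>p\<close> at \<open>y\<close> is
  \<open>p\<^sub>1\<close> at \<open>x\<close> divided by a power of the nonzero last coordinate.
  All representatives are treated because \<open>zero_locus\<close> demands vanishing at each of
  them.\<close>

lemma proj_pt_in_homogenization_iff:
  fixes p :: "'n::{finite,linorder} mpoly"
  assumes eq: "insertion ratfun_const (\<lambda>i. ratfun_var (Some i) / ratfun_var None) p =
      of_mpoly p\<^sub>1 / of_mpoly (Var None ^ e)"
  shows "proj_pt y \<in> hypersurface p\<^sub>1 \<longleftrightarrow> poly_eval y p = 0"
proof -
  have "eval_at p\<^sub>1 x = 0 \<longleftrightarrow> poly_eval y p = 0" if x: "x \<in> proj_pt y" for x
  proof -
    have x0: "x $ None \<noteq> 0" and xy: "(\<lambda>v. x $ Some v / x $ None) = y"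
      using proj_pt_coords[OF x] by blast+
    have "ratfun_eval (($) x) (ratfun_var (Some v) / ratfun_var None) (y v)" for v
      unfolding xy[symmetric] by (intro ratfun_eval_divide ratfun_eval_var x0)
    then have "ratfun_eval (($) x) (of_mpoly p\<^sub>1 / of_mpoly (Var None ^ e)) (poly_eval y p)"
      unfolding eq[symmetric] by (rule ratfun_eval_insertion)
    moreover have "ratfun_eval (($) x) (of_mpoly p\<^sub>1 / of_mpoly (Var None ^ e))
        (poly_eval (($) x) p\<^sub>1 / poly_eval (($) x) (Var None ^ e))"
      by (intro ratfun_eval_divide ratfun_eval_of_mpoly) (simp add: x0)
    ultimately have "poly_eval y p = poly_eval (($) x) p\<^sub>1 / poly_eval (($) x) (Var None ^ e)"
      by (rule ratfun_eval_unique)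
    then show ?thesis using x0 by (simp add: eval_at_eq_poly_eval)
  qed
  then show ?thesis
    using hom_coords_in_proj_pt[of y] by (auto simp: hypersurface_def zero_locus_def proj_pt_in_proj_points)
qed

lemma affine_part_hypersurface_nonempty:
  fixes F :: "'n::finite option mpoly"
  assumes "irreducible F" "homogeneous d F" "d \<ge> 2"
  shows "affine_part (hypersurface F) \<noteq> {}"
proof -
  obtain m m' where "m \<in> Poly_Mapping.keys F" "m' \<in> Poly_Mapping.keys F" "m \<noteq> m'"
    using irreducible_homogeneous_two_keys[OF assms] by blast
  then obtain z where z: "\<And>v. z v \<noteq> 0" "poly_eval z F = 0"
    using exists_zero_with_nonzero_coordinates by blast
  \<comment> \<open>Homogeneity permits division by the nonzero coordinate at \<open>None\<close>,
    which moves the zero into the chart.\<close>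
  define x where "x = (\<lambda>v. z (Some v) / z None)"
  have "case_option 1 x = (\<lambda>v. inverse (z None) * z v)"
    using z(1) by (auto simp: x_def fun_eq_iff divide_inverse split: option.split)
  then have "poly_eval (case_option 1 x) F = 0"
    using poly_eval_homogeneous[OF assms(2)] z(2) by simp
  then have "x \<in> affine_part (hypersurface F)"
    using z(1) by (simp add: affine_part_def proj_pt_in_hypersurface_iff[OF assms(2)] x_def)
  then show ?thesis by blast
qed

theorem theorem2p4:
  fixes k d :: nat
    and lam :: "nat \<Rightarrow> 'n::{finite,linorder} \<Rightarrow> complex"
    and F :: "'n option mpoly"
    and X X\<^sub>N\<^sub>C :: "(complex^'n option) set set"
  assumes "\<And>i j. i < k \<Longrightarrow> \<exists>m>0. lam i j ^ m = 1"
    and "irreducible F"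
    and "homogeneous d F"
    and "d \<ge> 2"
    and "\<And>i. i < k \<Longrightarrow> scale_vars (case_option 1 (lam i)) F = F"
    and "X = hypersurface F"
    and "noether_cremona_hypersurface (lifted_group k lam) F X\<^sub>N\<^sub>C"
  shows "birational (proj_variety X\<^sub>N\<^sub>C)
           (quotient_space (proj_variety X) (diag_group k lam) proj_action)"
proof -
  note lifted = lifted_group_eq[OF assms(1)]
  obtain \<alpha> p \<beta> q p\<^sub>1 e where
    field: "{r. \<forall>A\<in>lifted_group k lam. scale_ratfun (\<lambda>j. A $ Some j $ Some j) r = r} =
      adjoin (range (\<lambda>i. rational_monomial (\<alpha> i)))"
    and q: "q = (\<Prod>i\<in>UNIV. Var i ^ \<beta> i)"
    and f: "of_mpoly (dehomogenize F) =
      insertion ratfun_const (\<lambda>i. rational_monomial (\<alpha> i)) p /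
      insertion ratfun_const (\<lambda>i. rational_monomial (\<alpha> i)) q"
    and p\<^sub>1: "insertion ratfun_const (\<lambda>i. ratfun_var (Some i) / ratfun_var None) p =
      of_mpoly p\<^sub>1 / of_mpoly (Var None ^ e)"
    and Y: "X\<^sub>N\<^sub>C = hypersurface p\<^sub>1"
    using assms(7) unfolding noether_cremona_hypersurface_def by blast
  interpret torus_quotient "torus_group k lam" \<alpha>
  proof (rule torus_quotientI)
    show "finite_torus_subgroup (torus_group k lam)"
      by (rule finite_torus_subgroup_torus_group[OF assms(1)])
    show "{r. \<forall>s\<in>torus_group k lam. scale_ratfun s r = r} = adjoin (range (\<lambda>i. rational_monomial (\<alpha> i)))"
      using field by (simp add: lifted affine_diag_nth)
  qed
  have f_eval: "poly_eval (case_option 1 x) F = poly_eval (u x) p / poly_eval (u x) q"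
    and q_nonzero: "poly_eval (u x) q \<noteq> 0" if x: "x \<in> torus" for x
  proof -
    show q0: "poly_eval (u x) q \<noteq> 0" using u_torus[OF x] by (simp add: q)
    have "ratfun_eval x (rational_monomial (\<alpha> i)) (u x i)" for i
      unfolding u_def using x by (intro ratfun_eval_rational_monomial) simp
    then have "ratfun_eval x (of_mpoly (dehomogenize F)) (poly_eval (u x) p / poly_eval (u x) q)"
      unfolding f by (intro ratfun_eval_divide ratfun_eval_insertion q0)
    from ratfun_eval_unique[OF ratfun_eval_of_mpoly this]
    show "poly_eval (case_option 1 x) F = poly_eval (u x) p / poly_eval (u x) q"
      by (simp add: poly_eval_dehomogenize)
  qed
  show ?thesis
  proof (rule birational_quotient)
    show V: "X \<subseteq> proj_points" "X\<^sub>N\<^sub>C \<subseteq> proj_points"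
      by (auto simp: assms(6) Y hypersurface_def zero_locus_def)
    show "orbit (diag_group k lam) proj_action (proj_pt x) = proj_pt ` {z \<in> torus. u z = u x}"
      if x: "x \<in> torus" for x
    proof -
      \<comment> \<open>Fibres of \<open>u\<close> are orbits of \<open>torus_group\<close>, and
        scalars fix every projective point, so they are also the orbits of the projective
        group.\<close>
      have "{z \<in> torus. u z = u x} = (\<lambda>s v. s v * x v) ` torus_group k lam"
      proof (intro subset_antisym subsetI)
        fix z assume "z \<in> {z \<in> torus. u z = u x}"
        then have "z \<in> torus" "u x = u z" by auto
        then show "z \<in> (\<lambda>s v. s v * x v) ` torus_group k lam"
          using u_eq_iff[OF x, of z] by blast
      next
        fix z assume "z \<in> (\<lambda>s v. s v * x v) ` torus_group k lam"
        then obtain s where s: "s \<in> torus_group k lam" "z = (\<lambda>v. s v * x v)" by blast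
        then show "z \<in> {z \<in> torus. u z = u x}"
          using u_H[OF s(1)] H_action_torus[OF s(1) x] by simp
      qed
      then show ?thesis by (simp add: orbit_proj_pt[OF assms(1)] image_image)
    qed
    show "P \<in> orbit (diag_group k lam) proj_action P" if "P \<in> X" for P
      by (intro orbit_refl assms(1) subsetD[OF V(1) that])
    show "proj_pt x \<in> X \<longleftrightarrow> proj_pt (u x) \<in> X\<^sub>N\<^sub>C" if "x \<in> torus" for x
      unfolding assms(6) Y proj_pt_in_hypersurface_iff[OF assms(3)] proj_pt_in_homogenization_iff[OF p\<^sub>1]
      using f_eval[OF that] q_nonzero[OF that] by simp
    show "affine_part X \<noteq> {}"
      unfolding assms(6) by (rule affine_part_hypersurface_nonempty[OF assms(2-4)])
  qed
qed

end
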